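(* For every $2$-edge connected cubic graph $G$ (parallel edges allowed), the circular chromatic index satisfies $\chi_c'(G) \leq 11/3$.
   Context: Graphs are finite, may have parallel edges, but have no loops. A graph is cubic if every vertex has degree $3$ (counting parallel edges with multiplicity). A graph is $2$-edge connected if it is connected, has at least two vertices, and has no cut edge (bridge). For positive integers $p \geq q$, a $(p,q)$-coloring of a graph $G=(V,E)$ is a mapping $f: V \to \{0,1,\ldots,p-1\}$ such that for every edge $xy$ of $G$, $q \leq |f(x)-f(y)| \leq p-q$. The circular chromatic number of $G$ is $\chi_c(G) = \inf\{p/q : G \text{ has a } (p,q)\text{-coloring}\}$. The line graph $L(G)$ of $G$ has vertex set $E$, two distinct elements $e_1,e_2 \in E$ being adjacent if they have an end vertex in common (in particular, parallel edges are distinct adjacent vertices of $L(G)$). The circular chromatic index (also called circular edge chromatic number) of $G$ is $\chi_c'(G) = \chi_c(L(G))$. *)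

theory Defs
  imports Complex_Main
begin

text \<open>
  Undirected multigraphs: edges are first-class objects, and \<open>ends\<close> assigns to each
  edge its set of end vertices, so distinct edges may be parallel. Loops are excluded
  by requiring two distinct ends.
\<close>

record ('v, 'e) mgraph =
  verts :: "'v set"
  edges :: "'e set"
  ends :: "'e \<Rightarrow> 'v set"

definition multigraph :: "('v, 'e) mgraph \<Rightarrow> bool" where
  "multigraph G \<longleftrightarrow> finite (verts G) \<and> finite (edges G) \<and>
     (\<forall>e\<in>edges G. ends G e \<subseteq> verts G \<and> card (ends G e) = 2)"

definition degree :: "('v, 'e) mgraph \<Rightarrow> 'v \<Rightarrow> nat" where
  "degree G v = card {e \<in> edges G. v \<in> ends G e}"

definition cubic :: "('v, 'e) mgraph \<Rightarrow> bool" where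
  "cubic G \<longleftrightarrow> (\<forall>v\<in>verts G. degree G v = 3)"

definition adj_rel :: "('v, 'e) mgraph \<Rightarrow> ('v \<times> 'v) set" where
  "adj_rel G = {(x, y). \<exists>e\<in>edges G. ends G e = {x, y}}"

definition connected_graph :: "('v, 'e) mgraph \<Rightarrow> bool" where
  "connected_graph G \<longleftrightarrow> verts G \<noteq> {} \<and> (\<forall>x\<in>verts G. \<forall>y\<in>verts G. (x, y) \<in> (adj_rel G)\<^sup>*)"

definition components :: "('v, 'e) mgraph \<Rightarrow> 'v set set" where
  "components G = verts G // (adj_rel G)\<^sup>*"

definition delete_edge :: "('v, 'e) mgraph \<Rightarrow> 'e \<Rightarrow> ('v, 'e) mgraph" where
  "delete_edge G e = G\<lparr>edges := edges G - {e}\<rparr>"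

definition cut_edge :: "('v, 'e) mgraph \<Rightarrow> 'e \<Rightarrow> bool" where
  "cut_edge G e \<longleftrightarrow> e \<in> edges G \<and> card (components (delete_edge G e)) > card (components G)"

definition two_edge_connected :: "('v, 'e) mgraph \<Rightarrow> bool" where
  "two_edge_connected G \<longleftrightarrow>
     connected_graph G \<and> card (verts G) \<ge> 2 \<and> (\<nexists>e. cut_edge G e)"

text \<open>The difference of colours is taken in the integers, since subtraction on \<open>nat\<close> truncates.\<close>

definition pq_coloring :: "nat \<Rightarrow> nat \<Rightarrow> ('v, 'e) mgraph \<Rightarrow> ('v \<Rightarrow> nat) \<Rightarrow> bool" where
  "pq_coloring p q G f \<longleftrightarrow>
     (\<forall>v\<in>verts G. f v < p) \<and>
     (\<forall>e\<in>edges G. \<forall>x y. ends G e = {x, y} \<longrightarrow>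
        int q \<le> \<bar>int (f x) - int (f y)\<bar> \<and> \<bar>int (f x) - int (f y)\<bar> \<le> int p - int q)"

definition circular_ratios :: "('v, 'e) mgraph \<Rightarrow> real set" where
  "circular_ratios G = {real p / real q | p q. 0 < q \<and> q \<le> p \<and> (\<exists>f. pq_coloring p q G f)}"

definition circular_chromatic_number :: "('v, 'e) mgraph \<Rightarrow> real" where
  "circular_chromatic_number G = Inf (circular_ratios G)"

text \<open>The real infimum above is a genuine one: its set is bounded below and nonempty.\<close>

lemma bdd_below_circular_ratios: "bdd_below (circular_ratios G)"
  by (rule bdd_belowI[of _ 0]) (auto simp: circular_ratios_def)

lemma circular_ratios_nonempty:
  assumes "multigraph G"
  shows "circular_ratios G \<noteq> {}"
proof -
  have fin: "finite (verts G)" using assms by (simp add: multigraph_def)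
  obtain f :: "'a \<Rightarrow> nat" and n where f: "f ` verts G = {i. i < n}" "inj_on f (verts G)"
    using finite_imp_inj_to_nat_seg[OF fin] by blast
  have lt: "f v < n" if "v \<in> verts G" for v
    using f(1) that by blast
  have "pq_coloring (Suc n) 1 G f"
    unfolding pq_coloring_def
  proof (intro conjI ballI allI impI)
    fix e x y assume e: "e \<in> edges G" "ends G e = {x, y}"
    have "ends G e \<subseteq> verts G" "card (ends G e) = 2"
      using assms e(1) by (simp_all add: multigraph_def)
    then have xy: "x \<in> verts G" "y \<in> verts G" and "card {x, y} = 2"
      by (simp_all add: e(2))
    then have "x \<noteq> y" by auto
    with f(2) xy have "f x \<noteq> f y" by (auto dest: inj_onD)
    then show "int 1 \<le> \<bar>int (f x) - int (f y)\<bar>" by linarith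
  next
    fix e x y assume e: "e \<in> edges G" "ends G e = {x, y}"
    have "ends G e \<subseteq> verts G" using assms e(1) by (simp add: multigraph_def)
    then have xy: "x \<in> verts G" "y \<in> verts G" by (simp_all add: e(2))
    show "\<bar>int (f x) - int (f y)\<bar> \<le> int (Suc n) - int 1"
      using lt[OF xy(1)] lt[OF xy(2)] by linarith
  next
    fix v assume "v \<in> verts G"
    then show "f v < Suc n" using lt less_SucI by blast
  qed
  then have "real (Suc n) / real 1 \<in> circular_ratios G"
    unfolding circular_ratios_def by (intro CollectI exI[of _ "Suc n"] exI[of _ 1]) auto
  then show ?thesis by blast
qed

text \<open>The edges of the line graph are the two-element sets of distinct edges sharing an end.\<close>

definition line_graph :: "('v, 'e) mgraph \<Rightarrow> ('e, 'e set) mgraph" where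
  "line_graph G =
     \<lparr>verts = edges G,
      edges = {{e1, e2} | e1 e2. e1 \<in> edges G \<and> e2 \<in> edges G \<and> e1 \<noteq> e2 \<and>
                 ends G e1 \<inter> ends G e2 \<noteq> {}},
      ends = (\<lambda>s. s)\<rparr>"

lemma multigraph_line_graph:
  assumes "multigraph G"
  shows "multigraph (line_graph G)"
proof -
  have "edges (line_graph G) \<subseteq> Pow (edges G)" by (auto simp: line_graph_def)
  then have "finite (edges (line_graph G))"
    using assms by (meson finite_Pow_iff finite_subset multigraph_def)
  then show ?thesis
    using assms by (auto simp: multigraph_def line_graph_def)
qed

definition circular_chromatic_index :: "('v, 'e) mgraph \<Rightarrow> real" where
  "circular_chromatic_index G = circular_chromatic_number (line_graph G)"

end

theory Submission
  imports Defs "HOL-Combinatorics.Cycles"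
begin

text \<open>
  Colours are \<open>0, \<dots>, 10\<close>, read modulo 11, and edges with a common end get colours at circular
  distance at least 3. In a smallest counterexample, parallel edges, triangles and 4-cycles can be
  reduced: Frink's lemma replaces an edge and its four neighbours by two edges without creating
  a bridge, and a colouring of the smaller graph extends. Frink's lemma also yields Petersen's theorem,
  so the edges split into a perfect matching and cycles without short odd ones.

  The matching edges get colours \<open>t\<close> in \<open>{0, 1, 2}\<close>. An even cycle can then always be coloured
  with 5 and 8 alternately, and an odd cycle can be coloured as soon as it has four consecutive
  vertices whose matching edges satisfy \<open>max t\<^sub>0 t\<^sub>1 < min t\<^sub>2 t\<^sub>3\<close> or the reverse.
  To find such a \<open>t\<close>, label the matching edges low or high so that as many odd cycles as possible see the
  pattern low-low-high-high (or the reverse). An odd cycle without it contains, up to exchanging low and high,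
  low-low-high-low, and relabelling the last edge would repair it; by maximality this edge must therefore
  be needed by the cycle at its other end. Now give the colour 1 to all edges but one pair per odd cycle,
  which becomes 00 or 22 according to its label; every cycle that has the pattern can choose its pair
  of the label that no defective cycle asks to keep at 1, again by maximality.
\<close>

section \<open>Labelling the matching edges\<close>

text \<open>The colours at circular distance at least 3 from each of 0, 1, 2 are 5, 6, 7, 8, and
  among them only the pair 5, 8 has that distance. So an even cycle accepts any matching colours
  from {0, 1, 2}, while an odd cycle has to leave {5, ..., 8} somewhere. It climbs in steps of 3, as
  in 3, 6, 9 or 4, 7, 10 (or descends likewise). The colours below 5 and above 8 on the way are
  admissible only if the matching edges at one end of the climb are lower than those at the other;
  this is the origin of the four consecutive vertices. The obstacle is that a matching edge may join
  two odd cycles, so the cycles cannot be prepared one by one, and an extremal labelling has to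
  serve all of them at once. One relabelling need not repair a cycle that sees a single label only.
  The maximised quantity therefore also rewards cycles that see both labels, so that every position
  a defective cycle wants to keep in the middle stands for a strict gain.\<close>

definition orb :: "('v \<Rightarrow> 'v) \<Rightarrow> 'v \<Rightarrow> 'v set" where
  "orb s v = range (\<lambda>i. (s ^^ i) v)"

lemma orb_self: "v \<in> orb s v"
  unfolding orb_def by (rule range_eqI[of _ _ 0]) simp

lemma orb_step: "u \<in> orb s v \<Longrightarrow> s u \<in> orb s v"
  unfolding orb_def by (auto intro: range_eqI[of _ _ "Suc _"])

lemma orb_subset: "u \<in> orb s v \<Longrightarrow> orb s u \<subseteq> orb s v"
proof -
  assume "u \<in> orb s v"
  then have "(s ^^ n) u \<in> orb s v" for n
    by (induction n) (auto intro: orb_step)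
  then show ?thesis by (auto simp: orb_def)
qed

lemma orb_sym:
  assumes s: "permutation s" and u: "u \<in> orb s v"
  shows "v \<in> orb s u"
proof -
  obtain i where i: "u = (s ^^ i) v" using u by (auto simp: orb_def)
  define l where "l = least_power s v"
  have l: "l > 0" "(s ^^ l) v = v"
    using least_power_of_permutation[OF s] by (auto simp: l_def)
  have "l dvd i * l" by simp
  then have per: "(s ^^ (i * l)) v = v" unfolding l_def least_power_dvd[OF s] .
  have "i * l = (i * l - i) + i" using l(1) by simp
  then have "(s ^^ (i * l - i)) u = v"
    using per by (metis funpow_add i o_apply)
  then show ?thesis by (auto simp: orb_def)
qed

lemma orb_eq:
  assumes "permutation s" "u \<in> orb s v"
  shows "orb s u = orb s v"
  using orb_subset[OF assms(2)] orb_subset[OF orb_sym[OF assms]] by blast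

lemma least_power_orb:
  assumes s: "permutation s" and u: "u \<in> orb s v"
  shows "least_power s u = least_power s v"
proof -
  obtain i where i: "u = (s ^^ i) v" using u by (auto simp: orb_def)
  have inj: "inj (s ^^ i)"
    using s by (intro inj_fn bij_is_inj permutation_bijective)
  have "(s ^^ n) u = u \<longleftrightarrow> (s ^^ n) v = v" for n
  proof -
    have "(s ^^ n) u = (s ^^ i) ((s ^^ n) v)"
      using funpow_add[of n i s] funpow_add[of i n s] by (simp add: i add.commute fun_eq_iff)
    then show ?thesis using inj_eq[OF inj, of "(s ^^ n) v" v] by (simp only: i)
  qed
  then show ?thesis by (simp add: least_power_def)
qed

lemma orb_induct:
  assumes "u \<in> orb s v" "P v" "\<And>x. x \<in> orb s v \<Longrightarrow> P x \<Longrightarrow> P (s x)"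
  shows "P u"
proof -
  have "P ((s ^^ n) v)" for n
    by (induction n) (auto simp: assms(2) orb_def intro!: assms(3))
  then show ?thesis using assms(1) by (auto simp: orb_def)
qed

text \<open>The orbits of \<open>s\<close> are the oriented cycles of a 2-factor, and \<open>\<mu>\<close> maps a vertex to the other end of its
  matching edge, so labels of matching edges are \<open>\<mu>\<close>-invariant functions of the vertices.\<close>

locale matched_perm =
  fixes V :: "'v set" and s \<mu> :: "'v \<Rightarrow> 'v"
  assumes fin: "finite V"
    and s: "s permutes V"
    and mu_V: "v \<in> V \<Longrightarrow> \<mu> v \<in> V"
    and mu_mu: "v \<in> V \<Longrightarrow> \<mu> (\<mu> v) = v"
    and odd_long: "v \<in> V \<Longrightarrow> odd (least_power s v) \<Longrightarrow> 5 \<le> least_power s v"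
    and chord2: "v \<in> V \<Longrightarrow> odd (least_power s v) \<Longrightarrow> \<mu> v \<noteq> s (s v)"
    and chord3: "v \<in> V \<Longrightarrow> odd (least_power s v) \<Longrightarrow> \<mu> v \<noteq> s (s (s v))"
begin

lemma perm: "permutation s"
  using fin s permutation_permutes by blast

section \<open>Odd cycles of the 2-factor\<close>

definition odd_orbs :: "'v set set" where
  "odd_orbs = {orb s v | v. v \<in> V \<and> odd (least_power s v)}"

lemma finite_odd_orbs: "finite odd_orbs"
  unfolding odd_orbs_def using fin by simp

lemma odd_orbs_memD:
  assumes "D \<in> odd_orbs" "v \<in> D"
  shows "D = orb s v" "v \<in> V" "odd (least_power s v)" "5 \<le> least_power s v" "s v \<in> D"
proof -
  obtain x where x: "D = orb s x" "x \<in> V" "odd (least_power s x)"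
    using assms(1) by (auto simp: odd_orbs_def)
  have v: "v \<in> orb s x" using assms(2) x by simp
  show "D = orb s v" using orb_eq[OF perm v] x by simp
  show "v \<in> V"
    using v by (rule orb_induct) (use x s in \<open>auto simp: permutes_in_image\<close>)
  show "odd (least_power s v)" using least_power_orb[OF perm v] x by simp
  then show "5 \<le> least_power s v" using odd_long \<open>v \<in> V\<close> by blast
  show "s v \<in> D" using orb_step[OF v] x by simp
qed

lemma odd_orbs_nonempty: "D \<in> odd_orbs \<Longrightarrow> \<exists>v. v \<in> D"
  by (auto simp: odd_orbs_def intro: orb_self)

lemma odd_orbs_eq: "D \<in> odd_orbs \<Longrightarrow> D' \<in> odd_orbs \<Longrightarrow> v \<in> D \<Longrightarrow> v \<in> D' \<Longrightarrow> D = D'"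
  using odd_orbs_memD(1) by blast

lemma fun_ne:
  assumes "D \<in> odd_orbs" "v \<in> D" "0 < n" "n < 5"
  shows "(s ^^ n) v \<noteq> v"
  using odd_orbs_memD[OF assms(1,2)] least_power_le[of n s v] assms(3,4) by auto

lemma distinct4:
  assumes "D \<in> odd_orbs" "v \<in> D"
  shows "s v \<noteq> v" "s (s v) \<noteq> v" "s (s (s v)) \<noteq> v" "s (s v) \<noteq> s v"
    "s (s (s v)) \<noteq> s v" "s (s (s v)) \<noteq> s (s v)" "s (s (s (s v))) \<noteq> v"
proof -
  have 1: "s v \<noteq> v" "s (s v) \<noteq> v" "s (s (s v)) \<noteq> v" "s (s (s (s v))) \<noteq> v"
    if "v \<in> D" for v
    using fun_ne[OF assms(1) that, of 1] fun_ne[OF assms(1) that, of 2]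
      fun_ne[OF assms(1) that, of 3] fun_ne[OF assms(1) that, of 4]
    by (auto simp: numeral_eq_Suc)
  note cl = odd_orbs_memD(5)[OF assms(1)]
  show "s v \<noteq> v" "s (s v) \<noteq> v" "s (s (s v)) \<noteq> v" "s (s (s (s v))) \<noteq> v"
    using 1[OF assms(2)] .
  show "s (s v) \<noteq> s v" "s (s (s v)) \<noteq> s v" using 1[OF cl[OF assms(2)]] by blast+
  show "s (s (s v)) \<noteq> s (s v)" using 1[OF cl[OF cl[OF assms(2)]]] by blast
qed

section \<open>Labels, scores and single relabellings\<close>

definition monochr :: "('v \<Rightarrow> bool) \<Rightarrow> 'v set \<Rightarrow> bool" where
  "monochr w D \<longleftrightarrow> (\<exists>b. \<forall>v\<in>D. w v = b)"

definition good :: "('v \<Rightarrow> bool) \<Rightarrow> 'v set \<Rightarrow> bool" where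
  "good w D \<longleftrightarrow> (\<exists>v\<in>D. w (s v) = w v \<and> w (s (s v)) \<noteq> w v \<and> w (s (s (s v))) \<noteq> w v)"

text \<open>On odd orbits there are three levels: one label only, both labels without the pattern,
  and the pattern. An orbit that carries both labels after a change has lost at most one level,
  which is what the exchange arguments rely on.\<close>

definition score :: "('v \<Rightarrow> bool) \<Rightarrow> 'v set \<Rightarrow> nat" where
  "score w D = of_bool (\<not> monochr w D) + of_bool (good w D)"

definition invariant :: "('v \<Rightarrow> bool) \<Rightarrow> bool" where
  "invariant w \<longleftrightarrow> (\<forall>v\<in>V. w (\<mu> v) = w v)"

definition flip :: "'v \<Rightarrow> ('v \<Rightarrow> bool) \<Rightarrow> 'v \<Rightarrow> bool" where
  "flip u w = (\<lambda>v. if v = u \<or> v = \<mu> u then \<not> w v else w v)"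

lemma inv_flip:
  assumes "invariant w" "u \<in> V"
  shows "invariant (flip u w)"
  using assms mu_mu mu_V unfolding invariant_def flip_def by metis

lemma good_not_monochr: "D \<in> odd_orbs \<Longrightarrow> good w D \<Longrightarrow> \<not> monochr w D"
  unfolding good_def monochr_def using odd_orbs_memD(5) by metis

lemma score_cong:
  assumes "D \<in> odd_orbs" "\<And>v. v \<in> D \<Longrightarrow> w v = w' v"
  shows "score w D = score w' D"
proof -
  have "monochr w D = monochr w' D" using assms(2) by (auto simp: monochr_def)
  moreover have "good w D = good w' D"
    unfolding good_def using assms(2) odd_orbs_memD(5)[OF assms(1)] by (intro bex_cong) auto
  ultimately show ?thesis by (simp add: score_def)
qed

text \<open>Labels cannot alternate all the way round an orbit of odd length, so two consecutive
  ones agree. If agreement always propagated to the next position, the orbit would be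
  monochromatic.\<close>

lemma mono_pair_change:
  assumes D: "D \<in> odd_orbs" and nc: "\<not> monochr w D"
  shows "\<exists>v\<in>D. w (s v) = w v \<and> w (s (s v)) \<noteq> w v"
proof (rule ccontr)
  assume "\<not> ?thesis"
  then have step: "w (s (s v)) = w v" if "v \<in> D" "w (s v) = w v" for v
    using that by blast
  have "\<exists>v\<in>D. w (s v) = w v"
  proof (rule ccontr)
    assume no: "\<not> ?thesis"
    obtain v where v: "v \<in> D" using odd_orbs_nonempty[OF D] by blast
    have "(s ^^ n) v \<in> D \<and> w ((s ^^ n) v) = (w v = even n)" for n
      by (induction n) (use v no odd_orbs_memD(5)[OF D] in auto)
    from this[of "least_power s v"] show False
      using odd_orbs_memD(3)[OF D v] least_power_of_permutation(1)[OF perm, of v] by auto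
  qed
  then obtain v where v: "v \<in> D" "w (s v) = w v" by blast
  have "u \<in> D \<and> w u = w v \<and> w (s u) = w v" if "u \<in> orb s v" for u
    using that by (rule orb_induct) (use v step odd_orbs_memD(5)[OF D] in auto)
  then show False using nc odd_orbs_memD(1)[OF D v(1)] by (auto simp: monochr_def)
qed

text \<open>A defective orbit picks a monochromatic pair \<open>p, s p\<close> to receive an extreme value and a
  set \<open>W\<close> of positions that must keep the middle value.\<close>

definition choice_ok :: "('v \<Rightarrow> bool) \<Rightarrow> 'v set \<Rightarrow> 'v \<Rightarrow> 'v set \<Rightarrow> bool" where
  "choice_ok w D p W \<longleftrightarrow> p \<in> D \<and> W \<subseteq> D \<and> w (s p) = w p \<and> p \<notin> W \<and> s p \<notin> W
     \<and> (\<forall>u\<in>W. w u = w p \<and> score w D < score (flip u w) D)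
     \<and> (\<forall>z\<in>{s (s p), s (s (s p))}. w z \<noteq> w p \<or> z \<in> W)"

text \<open>In a monochromatic orbit any flip helps, since it changes at most two of the three
  distinct vertices \<open>u\<close>, \<open>s u\<close>, \<open>s (s u)\<close> and thus produces
  both labels. Otherwise some pair is followed by one position of the other label, and the missing
  pattern forces the next position \<open>u\<close> to repeat the label of the pair; flipping
  \<open>u\<close> completes the pattern.\<close>

lemma bad_choice:
  assumes w: "invariant w" and D: "D \<in> odd_orbs" and bad: "\<not> good w D"
  shows "\<exists>p W. choice_ok w D p W"
proof (cases "monochr w D")
  case True
  obtain p where p: "p \<in> D" using odd_orbs_nonempty[OF D] by blast
  have cl: "s p \<in> D" "s (s p) \<in> D" "s (s (s p)) \<in> D" "s (s (s (s p))) \<in> D"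
    using odd_orbs_memD(5)[OF D] p by blast+
  have same: "w x = w y" if "x \<in> D" "y \<in> D" for x y
    using True that by (auto simp: monochr_def)
  have "\<not> monochr (flip u w) D" if u: "u \<in> D" for u
  proof -
    have d: "u \<noteq> s u" "u \<noteq> s (s u)" "s u \<noteq> s (s u)"
      using distinct4[OF D u] by metis+
    have "s u \<in> D" "s (s u) \<in> D" using odd_orbs_memD(5)[OF D] u by blast+
    then obtain z where "z \<in> D" "z \<noteq> u" "z \<noteq> \<mu> u"
      using d by (cases "\<mu> u = s u") auto
    then have "flip u w z \<noteq> flip u w u"
      using same[of z u] u by (simp add: flip_def)
    then show ?thesis using u \<open>z \<in> D\<close> by (auto simp: monochr_def)
  qed
  then have "score w D < score (flip u w) D" if "u \<in> D" for u
    using that True bad by (simp add: score_def)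
  moreover have "w (s p) = w p" "w (s (s p)) = w p" "w (s (s (s p))) = w p"
    using same p cl by blast+
  ultimately have "choice_ok w D p {s (s p), s (s (s p))}"
    unfolding choice_ok_def using p cl distinct4[OF D p] by simp
  then show ?thesis by blast
next
  case False
  obtain p where p: "p \<in> D" "w (s p) = w p" "w (s (s p)) \<noteq> w p"
    using mono_pair_change[OF D False] by blast
  define u where "u = s (s (s p))"
  have cl: "s p \<in> D" "s (s p) \<in> D" "u \<in> D"
    using odd_orbs_memD(5)[OF D] p unfolding u_def by blast+
  have wu: "w u = w p" using bad p by (auto simp: good_def u_def)
  have V: "p \<in> V" "s p \<in> V" "u \<in> V" using odd_orbs_memD(2)[OF D] p cl by blast+
  \<comment> \<open>A flip at \<open>u\<close> also flips the other end of its matching edge. That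
    end spares the pair because it would otherwise be reached by a chord over three or two steps of
    the orbit.\<close>
  have m: "\<mu> u \<noteq> p" "\<mu> u \<noteq> s p"
    using chord3[OF V(1)] chord2[OF V(2)] mu_mu[OF V(3)]
      odd_orbs_memD(3)[OF D p(1)] odd_orbs_memD(3)[OF D cl(1)] by (auto simp: u_def)
  have "w (\<mu> u) = w u" using w V by (simp add: invariant_def)
  then have m2: "\<mu> u \<noteq> s (s p)" using wu p(3) by metis
  have "good (flip u w) D"
    unfolding good_def
    using p wu m m2 distinct4[OF D p(1)] by (intro bexI[of _ p]) (auto simp: flip_def u_def)
  then have sc: "score w D < score (flip u w) D"
    using bad good_not_monochr[OF D] False by (simp add: score_def)
  have "choice_ok w D p {u}"
    unfolding choice_ok_def using p cl wu sc distinct4[OF D p(1)] by (auto simp: u_def)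
  then show ?thesis by blast
qed

definition window :: "('v \<Rightarrow> nat) \<Rightarrow> 'v \<Rightarrow> bool" where
  "window t v \<longleftrightarrow>
     max (t v) (t (s v)) < min (t (s (s v))) (t (s (s (s v)))) \<or>
     max (t (s (s v))) (t (s (s (s v)))) < min (t v) (t (s v))"

section \<open>Maximal labellings and the exchange argument\<close>

lemma ex_maximal:
  "\<exists>w. invariant w \<and> (\<forall>w'. invariant w' \<longrightarrow> (\<Sum>D\<in>odd_orbs. score w' D) \<le> (\<Sum>D\<in>odd_orbs. score w D))"
proof (rule ex_has_greatest_nat)
  show "invariant (\<lambda>_. True)" by (simp add: invariant_def)
  show "\<forall>w. invariant w \<longrightarrow> (\<Sum>D\<in>odd_orbs. score w D) < Suc (2 * card odd_orbs)"
  proof (intro allI impI)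
    fix w
    have "(\<Sum>D\<in>odd_orbs. score w D) \<le> (\<Sum>D\<in>odd_orbs. 2)"
      by (rule sum_mono) (auto simp: score_def)
    then show "(\<Sum>D\<in>odd_orbs. score w D) < Suc (2 * card odd_orbs)" by simp
  qed
qed

lemma sum_score_less:
  assumes "D \<in> odd_orbs" "score w D < score w' D"
    "\<And>D'. D' \<in> odd_orbs \<Longrightarrow> D' \<noteq> D \<Longrightarrow> score w D' \<le> score w' D'"
  shows "(\<Sum>D\<in>odd_orbs. score w D) < (\<Sum>D\<in>odd_orbs. score w' D)"
  using finite_odd_orbs assms by (intro sum_strict_mono_ex1) (auto intro: less_imp_le)

text \<open>Two gains outweigh one loss of a single level. This pays for a double relabelling that
  serves two defective orbits at the expense of one good orbit.\<close>

lemma sum_score_less3: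
  assumes X: "X \<in> odd_orbs" "Y \<in> odd_orbs" "Z \<in> odd_orbs" "X \<noteq> Y" "X \<noteq> Z" "Y \<noteq> Z"
    "score w X < score w' X" "score w Y < score w' Y" "score w Z \<le> Suc (score w' Z)"
    "\<And>D. D \<in> odd_orbs \<Longrightarrow> D \<notin> {X, Y, Z} \<Longrightarrow> score w D \<le> score w' D"
  shows "(\<Sum>D\<in>odd_orbs. score w D) < (\<Sum>D\<in>odd_orbs. score w' D)"
proof -
  have split: "(\<Sum>D\<in>odd_orbs. score u D) = score u X + score u Y + score u Z + (\<Sum>D\<in>odd_orbs - {X, Y, Z}. score u D)"
    for u
  proof -
    have "(\<Sum>D\<in>odd_orbs. score u D) = (\<Sum>D\<in>{X, Y, Z}. score u D) + (\<Sum>D\<in>odd_orbs - {X, Y, Z}. score u D)"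
      using X finite_odd_orbs by (subst sum.subset_diff[of "{X, Y, Z}" odd_orbs]) auto
    then show ?thesis using X by simp
  qed
  have "(\<Sum>D\<in>odd_orbs - {X, Y, Z}. score w D) \<le> (\<Sum>D\<in>odd_orbs - {X, Y, Z}. score w' D)"
    using X(10) by (intro sum_mono) auto
  then show ?thesis using split[of w] split[of w'] X(7-9) by linarith
qed

theorem ex_windows:
  "\<exists>t. (\<forall>v. t v \<le> 2) \<and> (\<forall>v\<in>V. t (\<mu> v) = t v) \<and> (\<forall>D\<in>odd_orbs. \<exists>v\<in>D. window t v)"
proof -
  obtain w where w: "invariant w"
    and max: "\<And>w'. invariant w' \<Longrightarrow> (\<Sum>D\<in>odd_orbs. score w' D) \<le> (\<Sum>D\<in>odd_orbs. score w D)"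
    using ex_maximal by blast
  have wmu: "w (\<mu> v) = w v" if "v \<in> V" for v using w that by (simp add: invariant_def)
  obtain p0 W0 where bad: "\<And>D. D \<in> odd_orbs \<Longrightarrow> \<not> good w D \<Longrightarrow> choice_ok w D (p0 D) (W0 D)"
    using bad_choice[OF w] by metis
  define wanted where "wanted u \<longleftrightarrow> (\<exists>D\<in>odd_orbs. \<not> good w D \<and> u \<in> W0 D)" for u
  \<comment> \<open>a good orbit marks the type that nobody wants to keep in the middle; by maximality at most
    one type is wanted\<close>
  define btype where "btype D = (\<exists>u\<in>V. wanted u \<and> \<not> w u \<and> \<mu> u \<in> D)" for D
  \<comment> \<open>The pattern consists of one pair of each label. A good orbit is therefore free
    to choose the label of the pair it marks, and the other pair, behind or in front of it, has the
    opposite label.\<close>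
  have good_pair: "\<exists>p\<in>D. w p = b \<and> w (s p) = b \<and>
      ((w (s (s p)) \<noteq> b \<and> w (s (s (s p))) \<noteq> b) \<or> (\<exists>v\<in>D. p = s (s v) \<and> w v \<noteq> b \<and> w (s v) \<noteq> b))"
    if D: "D \<in> odd_orbs" and g: "good w D" for D b
  proof -
    obtain v where v: "v \<in> D" "w (s v) = w v" "w (s (s v)) \<noteq> w v" "w (s (s (s v))) \<noteq> w v"
      using g by (auto simp: good_def)
    show ?thesis
    proof (cases "w v = b")
      case True
      then show ?thesis using v by (intro bexI[of _ v]) auto
    next
      case False
      then show ?thesis using v odd_orbs_memD(5)[OF D] by (intro bexI[of _ "s (s v)"]) auto
    qed
  qed
  define pair where "pair D p \<longleftrightarrow> p \<in> D \<and> w p = btype D \<and> w (s p) = btype D \<and>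
      ((w (s (s p)) \<noteq> btype D \<and> w (s (s (s p))) \<noteq> btype D) \<or>
       (\<exists>v\<in>D. p = s (s v) \<and> w v \<noteq> btype D \<and> w (s v) \<noteq> btype D))" for D p
  have ex_pair: "\<exists>p. pair D p" if "D \<in> odd_orbs" "good w D" for D
    using good_pair[OF that, of "btype D"] unfolding pair_def Bex_def .
  define p1 where "p1 D = (SOME p. pair D p)" for D
  have p1': "pair D (p1 D)" if "D \<in> odd_orbs" "good w D" for D
    unfolding p1_def using ex_pair[OF that] by (rule someI_ex)
  note p1 = p1'[unfolded pair_def]
  define p where "p D = (if good w D then p1 D else p0 D)" for D
  have pD: "p D \<in> D" "s (p D) \<in> D" "w (s (p D)) = w (p D)" if "D \<in> odd_orbs" for D
    using that bad[OF that] p1[OF that] odd_orbs_memD(5)[OF that]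
    by (auto simp: p_def choice_ok_def)
  define K where "K = (\<Union>D\<in>odd_orbs. {p D, s (p D)})"
  \<comment> \<open>A mark belongs to the matching edge and is seen at both of its ends; the far end
    may lie in another orbit. A mark is harmless at a position whose label is opposite to that of
    the pair, since it pushes the value to the desired side. Only positions of the same label must
    stay unmarked.\<close>
  define M where "M = {v. v \<in> K \<or> (v \<in> V \<and> \<mu> v \<in> K)}"
  define t :: "'v \<Rightarrow> nat" where "t v = (if v \<in> M then (if w v then 2 else 0) else 1)" for v
  have KV: "K \<subseteq> V" using pD odd_orbs_memD(2) by (auto simp: K_def)
  have tmu: "t (\<mu> v) = t v" if "v \<in> V" for v
    using that KV mu_mu[OF that] mu_V[OF that] wmu[OF that] by (auto simp: t_def M_def)
  \<comment> \<open>A mark at \<open>u\<close> would come from the pair of an orbit \<open>E\<close>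
    at the other end of the matching edge. Flipping \<open>u\<close> is a gain for \<open>D\<close>,
    so maximality forces a loss in \<open>E\<close>; hence \<open>E\<close> differs from
    \<open>D\<close> and is good.\<close>
  have wanted_free: "u \<notin> M" if D: "D \<in> odd_orbs" and b: "\<not> good w D" and u: "u \<in> W0 D" for D u
  proof
    assume "u \<in> M"
    note ch = bad[OF D b, unfolded choice_ok_def]
    have uD: "u \<in> D" using ch u by blast
    have uV: "u \<in> V" using odd_orbs_memD(2)[OF D uD] .
    have gain: "score w D < score (flip u w) D" using ch u by blast
    have notp: "u \<notin> {p D, s (p D)}" using ch u b by (auto simp: p_def)
    have unch: "score w D' = score (flip u w) D'" if "D' \<in> odd_orbs" "D' \<noteq> D" "\<mu> u \<notin> D'" for D'
      using that odd_orbs_eq[OF D that(1) uD] by (intro score_cong) (auto simp: flip_def)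
    have ml: "\<not> ((\<Sum>D\<in>odd_orbs. score w D) < (\<Sum>D\<in>odd_orbs. score (flip u w) D))"
      using max[OF inv_flip[OF w uV]] by simp
    have "u \<notin> K"
    proof
      assume "u \<in> K"
      then obtain D' where D': "D' \<in> odd_orbs" "u \<in> {p D', s (p D')}" by (auto simp: K_def)
      then have "D' = D" using odd_orbs_eq[OF D D'(1) uD] pD[OF D'(1)] by auto
      then show False using D' notp by simp
    qed
    then have "\<mu> u \<in> K" using \<open>u \<in> M\<close> by (simp add: M_def)
    then obtain E where E: "E \<in> odd_orbs" "\<mu> u \<in> {p E, s (p E)}" by (auto simp: K_def)
    have uE: "\<mu> u \<in> E" using E pD[OF E(1)] by auto
    have wE: "w (p E) = w u" using E pD(3)[OF E(1)] wmu[OF uV] by auto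
    have "E \<noteq> D"
    proof
      assume "E = D"
      then have "\<mu> u \<notin> D'" if "D' \<in> odd_orbs" "D' \<noteq> D" for D'
        using odd_orbs_eq[OF D that(1)] uE that by blast
      then show False using sum_score_less[OF D gain] unch ml by (metis order_refl)
    qed
    have unch': "score w D' = score (flip u w) D'" if "D' \<in> odd_orbs" "D' \<noteq> D" "D' \<noteq> E" for D'
      using unch[OF that(1,2)] odd_orbs_eq[OF E(1) that(1) uE] that by blast
    have uE': "u \<notin> E" using odd_orbs_eq[OF D E(1) uD] \<open>E \<noteq> D\<close> by blast
    show False
    proof (cases "good w E")
      case False
      \<comment> \<open>The other member of the pair keeps its label, so \<open>E\<close> carries
        both labels after the flip. A defective orbit had no higher level to lose.\<close>
      have "\<exists>z\<in>{p E, s (p E)}. z \<noteq> \<mu> u"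
        using distinct4(1)[OF E(1) pD(1)[OF E(1)]] by (cases "\<mu> u = p E") auto
      then obtain z where z: "z \<in> {p E, s (p E)}" "z \<noteq> \<mu> u" by blast
      have "z \<in> E" "w z = w u" using z pD[OF E(1)] wE by auto
      then have "flip u w z \<noteq> flip u w (\<mu> u)"
        using z uE' wmu[OF uV] by (auto simp: flip_def)
      then have "\<not> monochr (flip u w) E" using \<open>z \<in> E\<close> uE by (auto simp: monochr_def)
      then have "score w E \<le> score (flip u w) E" using False by (simp add: score_def)
      then show False using sum_score_less[OF D gain] unch' ml by (metis order_refl)
    next
      case True
      have bt: "btype E = w u" using p1[OF E(1) True] wE True by (simp add: p_def)
      have "wanted u" using D b u by (auto simp: wanted_def)
      \<comment> \<open>If the label of \<open>u\<close> were false, \<open>u\<close> itself would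
        witness \<open>btype E\<close>, contrary to \<open>bt\<close>. So the label is true, and
        \<open>btype E\<close> supplies a second wanted position \<open>u'\<close>, of label false,
        whose matching edge also ends in \<open>E\<close>.\<close>
      then have wu: "w u" using bt uV uE by (auto simp: btype_def)
      then obtain u' where u': "u' \<in> V" "wanted u'" "\<not> w u'" "\<mu> u' \<in> E"
        using bt by (auto simp: btype_def)
      obtain D' where D': "D' \<in> odd_orbs" "\<not> good w D'" "u' \<in> W0 D'"
        using u'(2) by (auto simp: wanted_def)
      note ch' = bad[OF D'(1,2), unfolded choice_ok_def]
      have uD': "u' \<in> D'" using ch' D'(3) by blast
      have gain': "score w D' < score (flip u' w) D'" using ch' D'(3) by blast
      \<comment> \<open>All positions wanted by one orbit carry the label of its pair, whereas
        \<open>u\<close> and \<open>u'\<close> are labelled differently.\<close>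
      have "D' \<noteq> D" using ch ch' u D'(3) wu u'(3) by metis
      have "D' \<noteq> E" using True D' by blast
      have u'D: "u' \<notin> D" "\<mu> u' \<notin> D" "u' \<notin> E"
        using odd_orbs_eq[OF D D'(1) _ uD'] odd_orbs_eq[OF D E(1) _ u'(4)] odd_orbs_eq[OF E(1) D'(1) _ uD']
          \<open>D' \<noteq> D\<close> \<open>E \<noteq> D\<close> \<open>D' \<noteq> E\<close> by blast+
      have uD2: "u \<notin> D'" "\<mu> u \<notin> D'"
        using odd_orbs_eq[OF D D'(1) uD] odd_orbs_eq[OF E(1) D'(1) uE] \<open>D' \<noteq> D\<close> \<open>D' \<noteq> E\<close> by blast+
      \<comment> \<open>Both flips together raise \<open>D\<close> and \<open>D'\<close>. In
        \<open>E\<close> the two far ends receive opposite labels, so \<open>E\<close> stays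
        non-monochromatic and loses at most one level.\<close>
      define w' where "w' = flip u (flip u' w)"
      have inv': "invariant w'" unfolding w'_def by (intro inv_flip w uV u')
      have s1: "score w' D = score (flip u w) D"
        using u'D by (intro score_cong[OF D]) (auto simp: w'_def flip_def)
      have s2: "score w' D' = score (flip u' w) D'"
        using uD2 by (intro score_cong[OF D'(1)]) (auto simp: w'_def flip_def)
      have ne: "\<mu> u \<noteq> \<mu> u'" using wu u'(1,3) uV wmu by metis
      have "w' (\<mu> u) = False" "w' (\<mu> u') = True"
        using wu u'(1,3) uV wmu ne uE uE' u'(4) u'D by (auto simp: w'_def flip_def)
      then have "\<not> monochr w' E" using uE u'(4) by (auto simp: monochr_def)
      then have s3: "score w E \<le> Suc (score w' E)" by (auto simp: score_def)
      have s4: "score w F \<le> score w' F" if F: "F \<in> odd_orbs" "F \<notin> {D, D', E}" for F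
      proof -
        have "u \<notin> F" "\<mu> u \<notin> F" "u' \<notin> F" "\<mu> u' \<notin> F"
          using F odd_orbs_eq[OF F(1) D] odd_orbs_eq[OF F(1) D'(1)] odd_orbs_eq[OF F(1) E(1)] uD uD' uE u'(4) by auto
        then have "score w F = score w' F"
          by (intro score_cong[OF F(1)]) (auto simp: w'_def flip_def)
        then show ?thesis by simp
      qed
      have "(\<Sum>D\<in>odd_orbs. score w D) < (\<Sum>D\<in>odd_orbs. score w' D)"
        using sum_score_less3[OF D D'(1) E(1) _ _ _ _ _ s3 s4] gain gain' s1 s2
          \<open>D' \<noteq> D\<close> \<open>E \<noteq> D\<close> \<open>D' \<noteq> E\<close> by metis
      then show False using max[OF inv'] by simp
    qed
  qed
  have "\<exists>v\<in>D. window t v" if D: "D \<in> odd_orbs" for D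
  proof -
    have marked: "p D \<in> M" "s (p D) \<in> M" using D by (auto simp: M_def K_def)
    have tp: "t (p D) = (if w (p D) then 2 else 0)" "t (s (p D)) = (if w (p D) then 2 else 0)"
      using marked pD(3)[OF D] by (auto simp: t_def)
    have near: "if w (p D) then t z \<le> 1 else t z \<ge> 1" if "w z \<noteq> w (p D) \<or> z \<notin> M" for z
      using that by (auto simp: t_def)
    show ?thesis
    proof (cases "good w D")
      case True
      have pp: "p D = p1 D" "btype D = w (p D)" using True p1[OF D True] by (auto simp: p_def)
      consider "w (s (s (p D))) \<noteq> w (p D)" "w (s (s (s (p D)))) \<noteq> w (p D)"
        | v where "v \<in> D" "p D = s (s v)" "w v \<noteq> w (p D)" "w (s v) \<noteq> w (p D)"
        using p1[OF D True] pp by metis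
      then show ?thesis
      proof cases
        case 1
        then have "window t (p D)"
          using near[of "s (s (p D))"] near[of "s (s (s (p D)))"] tp
          by (auto simp: window_def split: if_splits)
        then show ?thesis using pD[OF D] by blast
      next
        case 2
        then have "window t v"
          using near[of v] near[of "s v"] tp
          by (auto simp: window_def split: if_splits)
        then show ?thesis using 2 by blast
      qed
    next
      case False
      note ch = bad[OF D False, unfolded choice_ok_def]
      have pp: "p D = p0 D" using False by (simp add: p_def)
      have "w z \<noteq> w (p D) \<or> z \<notin> M" if "z \<in> {s (s (p D)), s (s (s (p D)))}" for z
        using ch that wanted_free[OF D False] unfolding pp by blast
      then have "window t (p D)"
        using near[of "s (s (p D))"] near[of "s (s (s (p D)))"] tp
        by (auto simp: window_def split: if_splits)
      then show ?thesis using pD[OF D] by blast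
    qed
  qed
  moreover have "t v \<le> 2" for v by (simp add: t_def)
  ultimately show ?thesis using tmu by blast
qed

end

section \<open>Cuts in cubic multigraphs and Frink's reduction\<close>

definition crosses :: "'v set \<Rightarrow> 'v set \<Rightarrow> bool" where
  "crosses X S \<longleftrightarrow> X \<inter> S \<noteq> {} \<and> \<not> X \<subseteq> S"

lemma crosses_pair [simp]: "crosses {p, q} S \<longleftrightarrow> (p \<in> S) \<noteq> (q \<in> S)"
  by (auto simp: crosses_def)

definition cutset :: "('v, 'e) mgraph \<Rightarrow> 'v set \<Rightarrow> 'e set" where
  "cutset G S = {e \<in> edges G. crosses (ends G e) S}"

text \<open>The reductions may disconnect the graph or exhaust it, so the class for the inductions
  is described by cuts of vertex sets alone: a bridge is the only edge leaving some vertex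
  set.\<close>

definition bridgeless_cubic :: "('v, 'e) mgraph \<Rightarrow> bool" where
  "bridgeless_cubic G \<longleftrightarrow> multigraph G \<and> cubic G \<and> (\<forall>S\<subseteq>verts G. card (cutset G S) \<noteq> 1)"

definition incident :: "('v, 'e) mgraph \<Rightarrow> 'v \<Rightarrow> 'e set" where
  "incident G v = {e \<in> edges G. v \<in> ends G e}"

lemma card_filter: "finite A \<Longrightarrow> card {e \<in> A. P e} = (\<Sum>e\<in>A. of_bool (P e))"
  by (simp add: of_bool_def sum.If_cases Int_def)

lemma multigraph_ends:
  assumes "multigraph G" "e \<in> edges G" "v \<in> ends G e"
  obtains w where "ends G e = {v, w}" "w \<noteq> v" "v \<in> verts G" "w \<in> verts G"
proof -
  have c: "card (ends G e) = 2" "ends G e \<subseteq> verts G" using assms by (auto simp: multigraph_def)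
  obtain p q where pq: "ends G e = {p, q}" "p \<noteq> q" using c(1) by (auto simp: card_2_iff)
  show ?thesis
  proof (cases "v = p")
    case True
    then show ?thesis using that[of q] pq c(2) by auto
  next
    case False
    then have "v = q" using assms(3) pq by auto
    then show ?thesis using that[of p] pq c(2) by auto
  qed
qed

lemma multigraph_obtain_ends:
  assumes "multigraph G" "e \<in> edges G"
  obtains v w where "ends G e = {v, w}" "w \<noteq> v" "v \<in> verts G" "w \<in> verts G"
proof -
  have "card (ends G e) = 2" using assms by (auto simp: multigraph_def)
  then have "ends G e \<noteq> {}" by auto
  then obtain v where "v \<in> ends G e" by blast
  from multigraph_ends[OF assms this] show ?thesis using that by metis
qed

lemma bridgeless_cubicD:
  assumes "bridgeless_cubic G"
  shows "multigraph G" "cubic G" "finite (verts G)" "finite (edges G)"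
    "S \<subseteq> verts G \<Longrightarrow> card (cutset G S) \<noteq> 1" "v \<in> verts G \<Longrightarrow> card (incident G v) = 3"
  using assms by (auto simp: bridgeless_cubic_def multigraph_def cubic_def incident_def degree_def)

lemma incident3:
  assumes "bridgeless_cubic G" "v \<in> verts G" "e \<in> edges G" "v \<in> ends G e"
  obtains e2 e3 where "incident G v = {e, e2, e3}" "distinct [e, e2, e3]"
proof -
  have "card (incident G v) = 3" using bridgeless_cubicD(6)[OF assms(1,2)] .
  moreover have "e \<in> incident G v" using assms by (simp add: incident_def)
  ultimately have "card (incident G v - {e}) = 2" by simp
  then obtain e2 e3 where "incident G v - {e} = {e2, e3}" "e2 \<noteq> e3" by (auto simp: card_2_iff)
  moreover then have "incident G v = {e, e2, e3}" using \<open>e \<in> incident G v\<close> by blast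
  ultimately show ?thesis using that[of e2 e3] by auto
qed

lemma incident_eqI:
  assumes G: "bridgeless_cubic G" and v: "v \<in> verts G"
    and "A \<subseteq> incident G v" "card A = 3"
  shows "incident G v = A"
  using card_subset_eq[of "incident G v" A] assms bridgeless_cubicD(4)[OF G]
    bridgeless_cubicD(6)[OF G v] by (simp add: incident_def)

lemma incident_third:
  assumes G: "bridgeless_cubic G" and v: "v \<in> verts G"
    and e: "e1 \<in> edges G" "v \<in> ends G e1" "e2 \<in> edges G" "v \<in> ends G e2" "e1 \<noteq> e2"
  obtains e3 where "incident G v = {e1, e2, e3}" "distinct [e1, e2, e3]"
proof -
  obtain p q where pq: "incident G v = {e1, p, q}" "distinct [e1, p, q]"
    using incident3[OF G v e(1,2)] .
  have "e2 \<in> incident G v" using e by (simp add: incident_def)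
  then have "e2 = p \<or> e2 = q" using pq e by auto
  then show ?thesis using that[of p] that[of q] pq by auto
qed

lemma sum_degree:
  assumes G: "multigraph G" and S: "finite S"
  shows "(\<Sum>v\<in>S. card (incident G v)) = 2 * card {e \<in> edges G. ends G e \<subseteq> S} + card (cutset G S)"
proof -
  have fin: "finite (edges G)" using G by (simp add: multigraph_def)
  have "(\<Sum>v\<in>S. card (incident G v)) = (\<Sum>v\<in>S. \<Sum>e\<in>edges G. of_bool (v \<in> ends G e))"
    unfolding incident_def by (simp only: card_filter[OF fin])
  also have "\<dots> = (\<Sum>e\<in>edges G. \<Sum>v\<in>S. of_bool (v \<in> ends G e))"
    by (rule sum.swap)
  also have "\<dots> = (\<Sum>e\<in>edges G. 2 * of_bool (ends G e \<subseteq> S) + of_bool (crosses (ends G e) S))"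
  proof (rule sum.cong)
    fix e assume e: "e \<in> edges G"
    obtain v w where vw: "ends G e = {v, w}" "w \<noteq> v"
      using multigraph_obtain_ends[OF G e] .
    have "(\<Sum>u\<in>S. of_bool (u \<in> ends G e)) = card {u \<in> S. u \<in> ends G e}"
      by (simp only: card_filter[OF S])
    also have "{u \<in> S. u \<in> ends G e} = (if v \<in> S then {v} else {}) \<union> (if w \<in> S then {w} else {})"
      using vw by auto
    finally show "(\<Sum>u\<in>S. of_bool (u \<in> ends G e)) =
        2 * of_bool (ends G e \<subseteq> S) + (of_bool (crosses (ends G e) S) :: nat)"
      using vw by auto
  qed simp
  finally show ?thesis
    by (simp add: sum.distrib card_filter[OF fin] cutset_def flip: sum_distrib_left)
qed

text \<open>The three degrees add up to 9, so four inner edges leave room for exactly one edge to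
  the outside, which is a bridge.\<close>

lemma no_dense_triple:
  assumes G: "bridgeless_cubic G" and S: "S \<subseteq> verts G" "card S = 3"
    and T: "T \<subseteq> {e \<in> edges G. ends G e \<subseteq> S}" "card T \<ge> 4"
  shows False
proof -
  have finS: "finite S" using S(2) by (metis card.infinite zero_neq_numeral)
  have "(\<Sum>v\<in>S. card (incident G v)) = (\<Sum>v\<in>S. 3)"
    using bridgeless_cubicD(6)[OF G] S(1) by (intro sum.cong) auto
  then have "9 = 2 * card {e \<in> edges G. ends G e \<subseteq> S} + card (cutset G S)"
    using sum_degree[OF bridgeless_cubicD(1)[OF G] finS] S(2) by simp
  moreover have "card T \<le> card {e \<in> edges G. ends G e \<subseteq> S}"
    using bridgeless_cubicD(4)[OF G] by (intro card_mono T(1)) simp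
  ultimately have "card (cutset G S) = 1" using T(2) by presburger
  then show False using bridgeless_cubicD(5)[OF G S(1)] by blast
qed

definition perfect_matching :: "('v, 'e) mgraph \<Rightarrow> 'e set \<Rightarrow> bool" where
  "perfect_matching G M \<longleftrightarrow> M \<subseteq> edges G \<and> (\<forall>v\<in>verts G. \<exists>e\<in>M. v \<in> ends G e) \<and>
     (\<forall>e\<in>M. \<forall>e'\<in>M. ends G e \<inter> ends G e' \<noteq> {} \<longrightarrow> e = e')"

definition far :: "nat \<Rightarrow> nat \<Rightarrow> bool" where
  "far a b \<longleftrightarrow> 3 \<le> \<bar>int a - int b\<bar> \<and> \<bar>int a - int b\<bar> \<le> 8"

definition proper_at :: "('v, 'e) mgraph \<Rightarrow> ('e \<Rightarrow> nat) \<Rightarrow> 'v \<Rightarrow> bool" where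
  "proper_at G f v \<longleftrightarrow> (\<forall>e\<in>incident G v. \<forall>e'\<in>incident G v. e \<noteq> e' \<longrightarrow> far (f e) (f e'))"

definition edge_coloring :: "('v, 'e) mgraph \<Rightarrow> ('e \<Rightarrow> nat) \<Rightarrow> bool" where
  "edge_coloring G f \<longleftrightarrow> (\<forall>e\<in>edges G. f e < 11) \<and> (\<forall>v\<in>verts G. proper_at G f v)"

section \<open>Replacing an edge and its four neighbours by two edges\<close>

locale split_edge =
  fixes G :: "('v, 'e) mgraph" and x y h e1 e2 e3 e4 a b c d
  assumes G: "bridgeless_cubic G"
    and dist: "distinct [h, e1, e2, e3, e4]"
    and es: "h \<in> edges G" "e1 \<in> edges G" "e2 \<in> edges G" "e3 \<in> edges G" "e4 \<in> edges G"
    and ends: "ends G h = {x, y}" "ends G e1 = {x, a}" "ends G e2 = {x, b}"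
      "ends G e3 = {y, c}" "ends G e4 = {y, d}"
    and xy: "x \<noteq> y" and out: "{a, b, c, d} \<inter> {x, y} = {}"
begin

text \<open>The new edges \<open>ac\<close> and \<open>bd\<close> reuse the names \<open>e1\<close>
  and \<open>e2\<close>, so the type of edges is preserved and colourings of both graphs are
  functions on the same type. Exchanging the roles of \<open>e3\<close> and \<open>e4\<close> gives
  the other reduction, with new edges \<open>ad\<close> and \<open>bc\<close>.\<close>

definition G1 :: "('v, 'e) mgraph" where
  "G1 = \<lparr>verts = verts G - {x, y}, edges = edges G - {h, e3, e4},
     ends = (ends G)(e1 := {a, c}, e2 := {b, d})\<rparr>"

lemma G1_simps [simp]:
  "verts G1 = verts G - {x, y}" "edges G1 = edges G - {h, e3, e4}"
  "ends G1 e1 = {a, c}" "ends G1 e2 = {b, d}"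
  "e \<noteq> e1 \<Longrightarrow> e \<noteq> e2 \<Longrightarrow> ends G1 e = ends G e"
  using dist by (auto simp: G1_def)

lemma swap: "split_edge G x y h e1 e2 e4 e3 a b d c"
  using G dist es ends xy out by unfold_locales auto

definition E0 where "E0 = edges G - {h, e1, e2, e3, e4}"

lemma edges_G: "edges G = insert h (insert e1 (insert e2 (insert e3 (insert e4 E0))))"
  using es by (auto simp: E0_def)

lemma edges_G1: "edges G1 = insert e1 (insert e2 E0)"
  using es dist by (auto simp: E0_def)

lemma E0: "finite E0" "h \<notin> E0" "e1 \<notin> E0" "e2 \<notin> E0" "e3 \<notin> E0" "e4 \<notin> E0"
  using bridgeless_cubicD(4)[OF G] by (auto simp: E0_def)

lemma verts_in: "x \<in> verts G" "y \<in> verts G" "a \<in> verts G - {x, y}" "b \<in> verts G - {x, y}"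
  "c \<in> verts G - {x, y}" "d \<in> verts G - {x, y}"
proof -
  have "ends G e \<subseteq> verts G" if "e \<in> edges G" for e
    using bridgeless_cubicD(1)[OF G] that by (simp add: multigraph_def)
  from this[OF es(1)] this[OF es(2)] this[OF es(3)] this[OF es(4)] this[OF es(5)]
  show "x \<in> verts G" "y \<in> verts G" "a \<in> verts G - {x, y}" "b \<in> verts G - {x, y}"
    "c \<in> verts G - {x, y}" "d \<in> verts G - {x, y}"
    using ends out by auto
qed

lemma inc_x: "incident G x = {h, e1, e2}"
  using es ends dist by (intro incident_eqI[OF G verts_in(1)]) (auto simp: incident_def)

lemma inc_y: "incident G y = {h, e3, e4}"
  using es ends dist by (intro incident_eqI[OF G verts_in(2)]) (auto simp: incident_def)

lemma E0_ends:
  assumes "e \<in> E0"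
  shows "x \<notin> ends G e" "y \<notin> ends G e"
proof -
  have "e \<notin> incident G x" "e \<notin> incident G y" unfolding inc_x inc_y using assms by (auto simp: E0_def)
  then show "x \<notin> ends G e" "y \<notin> ends G e" using assms by (auto simp: E0_def incident_def)
qed

definition cut0 :: "'v set \<Rightarrow> nat" where
  "cut0 S = (\<Sum>e\<in>E0. of_bool (crosses (ends G e) S))"

lemma cut0_cong: "S \<inter> (verts G - {x, y}) = S' \<inter> (verts G - {x, y}) \<Longrightarrow> cut0 S = cut0 S'"
proof -
  assume eq: "S \<inter> (verts G - {x, y}) = S' \<inter> (verts G - {x, y})"
  have "crosses (ends G e) S = crosses (ends G e) S'" if e: "e \<in> E0" for e
  proof -
    have "ends G e \<subseteq> verts G - {x, y}"
      using E0_ends[OF e] e bridgeless_cubicD(1)[OF G] by (auto simp: E0_def multigraph_def)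
    then show ?thesis using eq unfolding crosses_def by blast
  qed
  then show ?thesis unfolding cut0_def by (intro sum.cong) auto
qed

lemma card_cut_G:
  "card (cutset G S) = cut0 S + of_bool ((x \<in> S) \<noteq> (y \<in> S)) + of_bool ((x \<in> S) \<noteq> (a \<in> S)) +
     of_bool ((x \<in> S) \<noteq> (b \<in> S)) + of_bool ((y \<in> S) \<noteq> (c \<in> S)) + of_bool ((y \<in> S) \<noteq> (d \<in> S))"
proof -
  have "card (cutset G S) = (\<Sum>e\<in>edges G. of_bool (crosses (ends G e) S))"
    using card_filter[OF bridgeless_cubicD(4)[OF G]] by (simp add: cutset_def)
  also have "\<dots> = cut0 S + of_bool ((x \<in> S) \<noteq> (y \<in> S)) + of_bool ((x \<in> S) \<noteq> (a \<in> S)) +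
     of_bool ((x \<in> S) \<noteq> (b \<in> S)) + of_bool ((y \<in> S) \<noteq> (c \<in> S)) + of_bool ((y \<in> S) \<noteq> (d \<in> S))"
    unfolding edges_G using E0 dist by (simp add: ends cut0_def)
  finally show ?thesis .
qed

lemma card_cut_G1:
  "card (cutset G1 S) = cut0 S + of_bool ((a \<in> S) \<noteq> (c \<in> S)) + of_bool ((b \<in> S) \<noteq> (d \<in> S))"
proof -
  have fin: "finite (edges G1)" using bridgeless_cubicD(4)[OF G] by simp
  have "card (cutset G1 S) = (\<Sum>e\<in>edges G1. of_bool (crosses (ends G1 e) S))"
    unfolding cutset_def by (rule card_filter[OF fin])
  also have "\<dots> = (\<Sum>e\<in>E0. of_bool (crosses (ends G1 e) S)) + of_bool ((a \<in> S) \<noteq> (c \<in> S)) +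
      of_bool ((b \<in> S) \<noteq> (d \<in> S))"
    unfolding edges_G1 using E0 dist by (simp del: sum_of_bool_eq)
  also have "(\<Sum>e\<in>E0. of_bool (crosses (ends G1 e) S)) = cut0 S"
    unfolding cut0_def using E0 by (intro sum.cong) (auto simp: E0_def)
  finally show ?thesis .
qed

text \<open>\<open>S\<close> can be completed in \<open>G\<close> by any subset of
  \<open>{x, y}\<close>. None of the four resulting cuts has size 1, and comparing the counts leaves
  one possibility: the bridge is an old edge, and the two new edges lie on opposite sides of
  it.\<close>

lemma cut1_cases:
  assumes S: "S \<subseteq> verts G1" "card (cutset G1 S) = 1"
  shows "cut0 S = 1" "(a \<in> S) = (c \<in> S)" "(b \<in> S) = (d \<in> S)" "(a \<in> S) \<noteq> (b \<in> S)"
proof -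
  have xyS: "x \<notin> S" "y \<notin> S" using S by auto
  have ne: "card (cutset G (S \<union> X)) \<noteq> 1" if "X \<subseteq> {x, y}" for X
    using S(1) that verts_in(1,2) by (intro bridgeless_cubicD(5)[OF G]) auto
  have c0: "cut0 (S \<union> X) = cut0 S" if "X \<subseteq> {x, y}" for X
    using that by (intro cut0_cong) auto
  have val: "card (cutset G (S \<union> X)) = cut0 S + of_bool ((x \<in> X) \<noteq> (y \<in> X)) +
      of_bool ((x \<in> X) \<noteq> (a \<in> S)) + of_bool ((x \<in> X) \<noteq> (b \<in> S)) +
      of_bool ((y \<in> X) \<noteq> (c \<in> S)) + of_bool ((y \<in> X) \<noteq> (d \<in> S))" if "X \<subseteq> {x, y}" for X
  proof -
    have "v \<in> S \<union> X \<longleftrightarrow> v \<in> S" if "v \<in> verts G - {x, y}" for v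
      using that \<open>X \<subseteq> {x, y}\<close> by auto
    from this[OF verts_in(3)] this[OF verts_in(4)] this[OF verts_in(5)] this[OF verts_in(6)]
    show ?thesis unfolding card_cut_G c0[OF that] using xyS by simp
  qed
  have "cut0 S + of_bool (a \<in> S) + of_bool (b \<in> S) + of_bool (c \<in> S) + of_bool (d \<in> S) \<noteq> 1"
    using ne[of "{}"] val[of "{}"] by simp
  moreover have "cut0 S + of_bool (a \<notin> S) + of_bool (b \<notin> S) + of_bool (c \<notin> S) + of_bool (d \<notin> S) \<noteq> 1"
    using ne[of "{x, y}"] val[of "{x, y}"] by simp
  moreover have "cut0 S + 1 + of_bool (a \<notin> S) + of_bool (b \<notin> S) + of_bool (c \<in> S) + of_bool (d \<in> S) \<noteq> 1"
    using ne[of "{x}"] val[of "{x}"] xy by simp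
  moreover have "cut0 S + 1 + of_bool (a \<in> S) + of_bool (b \<in> S) + of_bool (c \<notin> S) + of_bool (d \<notin> S) \<noteq> 1"
    using ne[of "{y}"] val[of "{y}"] xy by simp
  moreover have "1 = cut0 S + of_bool ((a \<in> S) \<noteq> (c \<in> S)) + of_bool ((b \<in> S) \<noteq> (d \<in> S))"
    using card_cut_G1[of S] S(2) by simp
  ultimately have "cut0 S = 1 \<and> (a \<in> S) = (c \<in> S) \<and> (b \<in> S) = (d \<in> S) \<and> (a \<in> S) \<noteq> (b \<in> S)"
    by (cases "a \<in> S"; cases "b \<in> S"; cases "c \<in> S"; cases "d \<in> S") simp_all
  then show "cut0 S = 1" "(a \<in> S) = (c \<in> S)" "(b \<in> S) = (d \<in> S)" "(a \<in> S) \<noteq> (b \<in> S)"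
    by blast+
qed

lemma cut0_obtain:
  assumes "cut0 S = 1"
  obtains f where "f \<in> E0" "crosses (ends G f) S" "\<And>e. e \<in> E0 \<Longrightarrow> crosses (ends G e) S \<Longrightarrow> e = f"
proof -
  have "card {e \<in> E0. crosses (ends G e) S} = 1"
    using assms card_filter[OF E0(1)] by (simp add: cut0_def)
  then obtain f where "{e \<in> E0. crosses (ends G e) S} = {f}" by (auto simp: card_1_singleton_iff)
  then show ?thesis using that[of f] by blast
qed

text \<open>The cut hypothesis also rules out loops. If \<open>a = c\<close>, the loop would use two
  of the three edge ends at \<open>a\<close>, so \<open>{a}\<close> would be left by exactly one
  edge; likewise for \<open>b = d\<close>. Without loops each vertex keeps its degree.\<close>

lemma G1_bridgeless_cubic:
  assumes "\<And>S. S \<subseteq> verts G1 \<Longrightarrow> card (cutset G1 S) \<noteq> 1"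
  shows "bridgeless_cubic G1"
proof -
  have mg: "multigraph G" using bridgeless_cubicD(1)[OF G] .
  define d0 where "d0 v = (\<Sum>e\<in>E0. of_bool (v \<in> ends G e) :: nat)" for v
  have deg: "3 = d0 v + of_bool (v = a) + of_bool (v = b) + of_bool (v = c) + of_bool (v = d)"
    if v: "v \<in> verts G1" for v
  proof -
    have "3 = card (incident G v)" using bridgeless_cubicD(6)[OF G] v by simp
    also have "\<dots> = (\<Sum>e\<in>edges G. of_bool (v \<in> ends G e))"
      unfolding incident_def by (rule card_filter[OF bridgeless_cubicD(4)[OF G]])
    also have "\<dots> = d0 v + of_bool (v = a) + of_bool (v = b) + of_bool (v = c) + of_bool (v = d)"
      unfolding edges_G using E0 dist v by (simp add: ends d0_def del: sum_of_bool_eq)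
    finally show ?thesis .
  qed
  have cut0_single: "cut0 {v} = d0 v" for v
    unfolding cut0_def d0_def
  proof (intro sum.cong refl arg_cong[where f = of_bool])
    fix e assume "e \<in> E0"
    then have "e \<in> edges G" by (simp add: E0_def)
    then obtain p q where "ends G e = {p, q}" "q \<noteq> p"
      using multigraph_obtain_ends[OF mg] by blast
    then show "crosses (ends G e) {v} = (v \<in> ends G e)" by auto
  qed
  have "d0 a + of_bool (c \<noteq> a) + of_bool ((b = a) \<noteq> (d = a)) \<noteq> 1"
    using assms[of "{a}"] verts_in(3) card_cut_G1[of "{a}"] cut0_single by simp
  moreover have "3 = d0 a + 1 + of_bool (a = b) + of_bool (a = c) + of_bool (a = d)"
    using deg[of a] verts_in(3) by simp
  ultimately have ac: "a \<noteq> c"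
    by (cases "a = b"; cases "a = c"; cases "a = d") auto
  have "d0 b + of_bool ((a = b) \<noteq> (c = b)) + of_bool (d \<noteq> b) \<noteq> 1"
    using assms[of "{b}"] verts_in(4) card_cut_G1[of "{b}"] cut0_single by simp
  moreover have "3 = d0 b + 1 + of_bool (b = a) + of_bool (b = c) + of_bool (b = d)"
    using deg[of b] verts_in(4) by simp
  ultimately have bd: "b \<noteq> d"
    by (cases "b = a"; cases "b = c"; cases "b = d") auto
  have "card (ends G1 e) = 2 \<and> ends G1 e \<subseteq> verts G1" if "e \<in> edges G1" for e
  proof -
    consider "e = e1" | "e = e2" | "e \<in> E0" using \<open>e \<in> edges G1\<close> unfolding edges_G1 by blast
    then show ?thesis
    proof cases
      case 3
      then have "e \<noteq> e1" "e \<noteq> e2" "e \<in> edges G" using E0 by (auto simp: E0_def)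
      then show ?thesis using E0_ends[OF 3] mg by (auto simp: multigraph_def)
    qed (use ac bd verts_in in auto)
  qed
  then have "multigraph G1" using bridgeless_cubicD(3,4)[OF G] by (simp add: multigraph_def)
  moreover have "degree G1 v = 3" if v: "v \<in> verts G1" for v
  proof -
    have fin: "finite (edges G1)" using bridgeless_cubicD(4)[OF G] by simp
    have "degree G1 v = (\<Sum>e\<in>edges G1. of_bool (v \<in> ends G1 e))"
      unfolding degree_def by (rule card_filter[OF fin])
    also have "\<dots> = (\<Sum>e\<in>E0. of_bool (v \<in> ends G1 e)) + of_bool (v \<in> {a, c}) + of_bool (v \<in> {b, d})"
      unfolding edges_G1 using E0 dist by (simp del: sum_of_bool_eq)
    also have "(\<Sum>e\<in>E0. of_bool (v \<in> ends G1 e)) = d0 v"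
      unfolding d0_def using E0 by (intro sum.cong) (auto simp: E0_def)
    finally show ?thesis using deg[OF v] ac bd by (auto simp: of_bool_def split: if_splits)
  qed
  ultimately show ?thesis using assms by (simp add: bridgeless_cubic_def cubic_def)
qed

end

text \<open>Frink's lemma. If both reductions had a bridge, the corresponding two vertex sets would
  cut the rest of the graph into four quarters, one around each of \<open>a, b, c, d\<close>; only two
  edges run between the quarters, so some quarter is left by one edge of \<open>G\<close> only.\<close>

lemma frink:
  assumes "split_edge G x y h e1 e2 e3 e4 a b c d"
  shows "bridgeless_cubic (split_edge.G1 G x y h e1 e2 e3 e4 a b c d) \<or>
    bridgeless_cubic (split_edge.G1 G x y h e1 e2 e4 e3 a b d c)"
proof (rule ccontr)
  interpret A: split_edge G x y h e1 e2 e3 e4 a b c d by (rule assms)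
  interpret B: split_edge G x y h e1 e2 e4 e3 a b d c by (rule A.swap)
  assume neg: "\<not> (bridgeless_cubic A.G1 \<or> bridgeless_cubic B.G1)"
  obtain S1 where S1: "S1 \<subseteq> verts A.G1" "card (cutset A.G1 S1) = 1"
    using A.G1_bridgeless_cubic neg by blast
  obtain S2 where S2: "S2 \<subseteq> verts B.G1" "card (cutset B.G1 S2) = 1"
    using B.G1_bridgeless_cubic neg by blast
  have E0: "B.E0 = A.E0" by (auto simp: A.E0_def B.E0_def)
  then have cut0: "B.cut0 = A.cut0" by (simp add: A.cut0_def B.cut0_def fun_eq_iff)
  note C1 = A.cut1_cases[OF S1]
  note C2 = B.cut1_cases[OF S2, unfolded cut0]
  obtain f1 where f1: "f1 \<in> A.E0" "crosses (ends G f1) S1"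
    "\<And>e. e \<in> A.E0 \<Longrightarrow> crosses (ends G e) S1 \<Longrightarrow> e = f1"
    using A.cut0_obtain[OF C1(1)] by metis
  obtain f2 where f2: "f2 \<in> A.E0" "crosses (ends G f2) S2"
    "\<And>e. e \<in> A.E0 \<Longrightarrow> crosses (ends G e) S2 \<Longrightarrow> e = f2"
    using A.cut0_obtain[OF C2(1)] by metis
  have mg: "multigraph G" using bridgeless_cubicD(1)[OF A.G] .
  have in_G: "e \<in> edges G" if "e \<in> A.E0" for e using that by (simp add: A.E0_def)
  have sub: "S1 \<subseteq> verts G - {x, y}" "S2 \<subseteq> verts G - {x, y}" using S1 S2 by auto
  obtain p q where pq: "ends G f1 = {p, q}" using multigraph_obtain_ends[OF mg in_G[OF f1(1)]] .
  obtain r t where rt: "ends G f2 = {r, t}" using multigraph_obtain_ends[OF mg in_G[OF f2(1)]] .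
  define Q where "Q i j = {v \<in> verts G - {x, y}. (v \<in> S1) = i \<and> (v \<in> S2) = j}" for i j
  have Qin: "v \<in> Q i j \<longleftrightarrow> (v \<in> S1) = i \<and> (v \<in> S2) = j" if "v \<in> verts G - {x, y}" for v i j
    using that by (simp add: Q_def)
  have E0V: "v \<in> verts G - {x, y}" if "e \<in> A.E0" "v \<in> ends G e" for e v
    using A.E0_ends[OF that(1)] in_G[OF that(1)] that(2) mg by (auto simp: multigraph_def)
  \<comment> \<open>Each quarter contains exactly one of \<open>a\<close>, \<open>b\<close>,
    \<open>c\<close>, \<open>d\<close>, so exactly one edge at \<open>x\<close> or \<open>y\<close>
    crosses it. Being the only one would make it a bridge of \<open>G\<close>, so an edge of
    \<open>E0\<close> crosses too, and its ends differ with respect to \<open>S1\<close> or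
    \<open>S2\<close>.\<close>
  have hit: "crosses (ends G f1) (Q i j) \<or> crosses (ends G f2) (Q i j)" for i j
  proof -
    have xyQ: "x \<notin> Q i j" "y \<notin> Q i j" by (auto simp: Q_def)
    have "card (cutset G (Q i j)) = A.cut0 (Q i j) + 1"
      unfolding A.card_cut_G using xyQ C1(2-4) C2(2-4)
      by (auto simp: Qin[OF A.verts_in(3)] Qin[OF A.verts_in(4)] Qin[OF A.verts_in(5)] Qin[OF A.verts_in(6)])
    moreover have "card (cutset G (Q i j)) \<noteq> 1"
      using bridgeless_cubicD(5)[OF A.G] by (auto simp: Q_def)
    ultimately have "A.cut0 (Q i j) \<noteq> 0" by simp
    then obtain e where e: "e \<in> A.E0" "crosses (ends G e) (Q i j)"
      by (auto simp: A.cut0_def A.E0(1))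
    obtain u v where uv: "ends G e = {u, v}" using multigraph_obtain_ends[OF mg in_G[OF e(1)]] .
    have uvV: "u \<in> verts G - {x, y}" "v \<in> verts G - {x, y}" using E0V[OF e(1)] uv by auto
    have "crosses (ends G e) S1 \<or> crosses (ends G e) S2"
      using e(2) unfolding uv crosses_pair Qin[OF uvV(1)] Qin[OF uvV(2)] by blast
    then show ?thesis using e f1(3) f2(3) by blast
  qed
  have V: "p \<in> verts G - {x, y}" "q \<in> verts G - {x, y}" "r \<in> verts G - {x, y}" "t \<in> verts G - {x, y}"
    using E0V[OF f1(1)] E0V[OF f2(1)] pq rt by auto
  show False
  proof (cases "f1 = f2")
    case True
    then have "crosses (ends G f1) S1" "crosses (ends G f1) S2" using f1(2) f2(2) by simp_all
    then have "(p \<in> S1) \<noteq> (q \<in> S1)" "(p \<in> S2) \<noteq> (q \<in> S2)" by (simp_all add: pq)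
    \<comment> \<open>An edge crossing both sets joins opposite quarters; the quarter named here
      contains neither end.\<close>
    moreover have "crosses (ends G f1) (Q (p \<in> S1) (q \<in> S2))"
      using hit True by simp
    ultimately show False by (simp add: pq Qin[OF V(1)] Qin[OF V(2)])
  next
    case False
    then have "\<not> crosses (ends G f1) S2" "\<not> crosses (ends G f2) S1" using f1 f2 by blast+
    then have "(p \<in> S2) = (q \<in> S2)" "(r \<in> S1) = (t \<in> S1)" by (simp_all add: pq rt)
    \<comment> \<open>\<open>f1\<close> stays on one side of \<open>S2\<close> and \<open>f2\<close>
      on one side of \<open>S1\<close>, so the quarter on the other side of both is missed.\<close>
    then show False
      using hit[of "r \<notin> S1" "p \<notin> S2"]
      by (simp add: pq rt Qin[OF V(1)] Qin[OF V(2)] Qin[OF V(3)] Qin[OF V(4)])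
  qed
qed

section \<open>Lifting along the reductions; perfect matchings\<close>

context split_edge
begin

lemma G1_ends_distinct:
  assumes "multigraph G1"
  shows "a \<noteq> c" "b \<noteq> d"
proof -
  have "e1 \<in> edges G1" "e2 \<in> edges G1" using es dist by auto
  then have "card (ends G1 e1) = 2" "card (ends G1 e2) = 2"
    using assms unfolding multigraph_def by blast+
  then show "a \<noteq> c" "b \<noteq> d" by auto
qed

lemma ends_cases:
  assumes "e \<in> edges G" "v \<in> ends G e" "v \<notin> {x, y}"
  obtains "e = e1" "v = a" | "e = e2" "v = b" | "e = e3" "v = c" | "e = e4" "v = d" | "e \<in> E0"
  using assms ends by (auto simp: edges_G)

text \<open>Both halves of a new edge inherit its colour, so each vertex other than \<open>x\<close>
  and \<open>y\<close> sees the same colours as before; \<open>a \<noteq> c\<close> and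
  \<open>b \<noteq> d\<close> make the map \<open>\<phi>\<close> injective on the edges at such a
  vertex. The colour of \<open>h\<close> and the conditions at \<open>x\<close> and \<open>y\<close>
  are settled separately for each configuration.\<close>

lemma lift_coloring:
  assumes G1: "multigraph G1" and f: "edge_coloring G1 f"
  defines "g \<equiv> f(e3 := f e1, e4 := f e2)"
  shows "\<And>e. e \<in> edges G \<Longrightarrow> e \<noteq> h \<Longrightarrow> g e < 11" "\<And>v. v \<in> verts G - {x, y} \<Longrightarrow> proper_at G g v"
proof -
  have f11: "f e < 11" if "e \<in> edges G1" for e using f that by (simp add: edge_coloring_def)
  show "g e < 11" if "e \<in> edges G" "e \<noteq> h" for e
    using that f11[of e] f11[of e1] f11[of e2] es dist by (auto simp: g_def)
next
  note ne = G1_ends_distinct[OF G1]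
  define \<phi> where "\<phi> e = (if e = e3 then e1 else if e = e4 then e2 else e)" for e
  fix v assume v: "v \<in> verts G - {x, y}"
  have img: "\<phi> e \<in> incident G1 v" "g e = f (\<phi> e)" if "e \<in> incident G v" for e
  proof -
    have e: "e \<in> edges G" "v \<in> ends G e" using that by (auto simp: incident_def)
    show "g e = f (\<phi> e)" using dist by (simp add: g_def \<phi>_def)
    show "\<phi> e \<in> incident G1 v"
      using e(1) by (rule ends_cases[OF _ e(2)])
        (use v dist es e E0 in \<open>auto simp: incident_def \<phi>_def E0_def\<close>)
  qed
  have inj: "e = e'" if "e \<in> incident G v" "e' \<in> incident G v" "\<phi> e = \<phi> e'" for e e'
  proof -
    have e: "v \<in> ends G e" "v \<in> ends G e'" using that by (auto simp: incident_def)
    show ?thesis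
      using that(3) e v ne ends dist by (auto simp: \<phi>_def split: if_splits)
  qed
  have "proper_at G1 f v" using f v by (simp add: edge_coloring_def)
  then show "proper_at G g v"
    unfolding proper_at_def using img inj by metis
qed

text \<open>If \<open>ac\<close> is matched, its halves \<open>xa\<close> and \<open>yc\<close>
  cover \<open>x\<close> and \<open>y\<close>; otherwise the edge \<open>xy\<close> does.\<close>

lemma lift_matching:
  assumes G1: "multigraph G1" and M: "perfect_matching G1 M" "e2 \<notin> M"
  shows "perfect_matching G (insert (if e1 \<in> M then e3 else h) M)"
proof -
  note ne = G1_ends_distinct[OF G1]
  define N where "N = insert (if e1 \<in> M then e3 else h) M"
  have ME: "M \<subseteq> edges G1" using M by (simp add: perfect_matching_def)
  have sub: "N \<subseteq> edges G" using ME es by (auto simp: N_def)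
  have M0: "e = e1 \<or> e \<in> E0" if "e \<in> M" for e
    using that ME M(2) unfolding edges_G1 by blast
  have E0_ends_eq: "ends G1 e = ends G e" if "e \<in> E0" for e
    using that E0 by (metis G1_simps(5))
  have cover1: "\<exists>e\<in>M. v \<in> ends G1 e" if "v \<in> verts G - {x, y}" for v
    using M(1) that by (simp add: perfect_matching_def)
  have disj1: "e = e'" if "e \<in> M" "e' \<in> M" "v \<in> ends G1 e" "v \<in> ends G1 e'" for e e' v
    using M(1) that unfolding perfect_matching_def by blast
  have cover: "\<exists>e\<in>N. v \<in> ends G e" if v: "v \<in> verts G" for v
  proof (cases "v \<in> {x, y}")
    case True
    then show ?thesis using ends
      by (intro bexI[of _ "if e1 \<notin> M then h else if v = x then e1 else e3"]) (auto simp: N_def)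
  next
    case False
    then obtain e where e: "e \<in> M" "v \<in> ends G1 e" using cover1 v by blast
    from M0[OF e(1)] show ?thesis
    proof
      assume "e = e1"
      then show ?thesis using e ends
        by (intro bexI[of _ "if v = a then e1 else e3"]) (auto simp: N_def)
    next
      assume "e \<in> E0"
      then show ?thesis using e E0_ends_eq by (auto simp: N_def)
    qed
  qed
  have disj: "e = e'" if e: "e \<in> N" "e' \<in> N" "v \<in> ends G e" "v \<in> ends G e'" for e e' v
  proof -
    have c: "e \<in> E0 \<and> e \<in> M \<or> e \<in> {e1, e3} \<and> e1 \<in> M \<or> e = h \<and> e1 \<notin> M" if "e \<in> N" for e
      using that M0 by (auto simp: N_def split: if_splits)
    have E0x: "v \<notin> {x, y}" if "e \<in> E0" "v \<in> ends G e" for e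
      using E0_ends[OF that(1)] that(2) by auto
    have E0e1: "v \<notin> {a, c}" if "e \<in> E0" "e \<in> M" "v \<in> ends G e" "e1 \<in> M" for e
      using disj1[of e e1 v] that E0_ends_eq[of e] E0 by auto
    consider "e \<in> E0" "e \<in> M" "e' \<in> E0" "e' \<in> M"
      | "e \<in> E0" "e \<in> M" "e' \<in> {e1, e3}" "e1 \<in> M" | "e' \<in> E0" "e' \<in> M" "e \<in> {e1, e3}" "e1 \<in> M"
      | "e \<in> E0" "e' = h" | "e' \<in> E0" "e = h"
      | "e \<in> {e1, e3}" "e' \<in> {e1, e3}" | "e = h" "e' = h"
      using c[OF e(1)] c[OF e(2)] by blast
    then show ?thesis
    proof cases
      case 1
      then show ?thesis using disj1 e E0_ends_eq by metis
    next
      case 2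
      then show ?thesis using E0x[OF 2(1) e(3)] E0e1[OF 2(1,2) e(3) 2(4)] e(4) ends by auto
    next
      case 3
      then show ?thesis using E0x[OF 3(1) e(4)] E0e1[OF 3(1,2) e(4) 3(4)] e(3) ends by auto
    next
      case 4
      then show ?thesis using E0x[OF 4(1) e(3)] e(4) ends by auto
    next
      case 5
      then show ?thesis using E0x[OF 5(1) e(4)] e(3) ends by auto
    next
      case 6
      then show ?thesis using e(3,4) ends ne xy out by auto
    qed simp
  qed
  show ?thesis
    unfolding perfect_matching_def N_def[symmetric] using sub cover disj by blast
qed

end

section \<open>Suppressing a pair of parallel edges\<close>

locale digon =
  fixes G :: "('v, 'e) mgraph" and u v h h' g k w w'
  assumes G: "bridgeless_cubic G"
    and dist: "distinct [h, h', g, k]"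
    and es: "h \<in> edges G" "h' \<in> edges G" "g \<in> edges G" "k \<in> edges G"
    and ends: "ends G h = {u, v}" "ends G h' = {u, v}" "ends G g = {u, w}" "ends G k = {v, w'}"
    and uv: "u \<noteq> v" and out: "{w, w'} \<inter> {u, v} = {}"
begin

definition G1 :: "('v, 'e) mgraph" where
  "G1 = \<lparr>verts = verts G - {u, v}, edges = edges G - {h, h', k}, ends = (ends G)(g := {w, w'})\<rparr>"

lemma G1_simps [simp]:
  "verts G1 = verts G - {u, v}" "edges G1 = edges G - {h, h', k}"
  "ends G1 g = {w, w'}" "e \<noteq> g \<Longrightarrow> ends G1 e = ends G e"
  by (auto simp: G1_def)

definition E0 where "E0 = edges G - {h, h', g, k}"

lemma edges_G: "edges G = insert h (insert h' (insert g (insert k E0)))"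
  using es by (auto simp: E0_def)

lemma edges_G1: "edges G1 = insert g E0"
  using es dist by (auto simp: E0_def)

lemma E0: "finite E0" "h \<notin> E0" "h' \<notin> E0" "g \<notin> E0" "k \<notin> E0"
  using bridgeless_cubicD(4)[OF G] by (auto simp: E0_def)

lemma verts_in: "u \<in> verts G" "v \<in> verts G" "w \<in> verts G - {u, v}" "w' \<in> verts G - {u, v}"
proof -
  have "ends G e \<subseteq> verts G" if "e \<in> edges G" for e
    using bridgeless_cubicD(1)[OF G] that by (simp add: multigraph_def)
  from this[OF es(1)] this[OF es(3)] this[OF es(4)]
  show "u \<in> verts G" "v \<in> verts G" "w \<in> verts G - {u, v}" "w' \<in> verts G - {u, v}"
    using ends out by auto
qed

lemma inc_u: "incident G u = {h, h', g}"
  using es ends dist by (intro incident_eqI[OF G verts_in(1)]) (auto simp: incident_def)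

lemma inc_v: "incident G v = {h, h', k}"
  using es ends dist by (intro incident_eqI[OF G verts_in(2)]) (auto simp: incident_def)

lemma E0_ends:
  assumes "e \<in> E0"
  shows "u \<notin> ends G e" "v \<notin> ends G e"
proof -
  have "e \<notin> incident G u" "e \<notin> incident G v" unfolding inc_u inc_v using assms by (auto simp: E0_def)
  then show "u \<notin> ends G e" "v \<notin> ends G e" using assms by (auto simp: E0_def incident_def)
qed

lemma ends_neq: "w \<noteq> w'"
proof
  assume eq: "w = w'"
  have "card {u, v, w} = 3" using uv out by auto
  moreover have "{u, v, w} \<subseteq> verts G" using verts_in by auto
  moreover have "{h, h', g, k} \<subseteq> {e \<in> edges G. ends G e \<subseteq> {u, v, w}}"
    using es ends eq by auto
  moreover have "card {h, h', g, k} \<ge> 4" using dist by simp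
  ultimately show False using no_dense_triple[OF G] by metis
qed

text \<open>With \<open>u\<close> and \<open>v\<close> placed on the side of \<open>w\<close>, the
  edge \<open>k\<close> crosses exactly when the new edge \<open>ww'\<close> does, so the cut has
  the same size in \<open>G\<close>.\<close>

lemma cut_G1_neq_1:
  assumes S: "S \<subseteq> verts G1"
  shows "card (cutset G1 S) \<noteq> 1"
proof -
  define S' where "S' = S \<union> (if w \<in> S then {u, v} else {})"
  have uvS: "u \<notin> S" "v \<notin> S" using S by auto
  have mem: "z \<in> S' \<longleftrightarrow> z \<in> S" if "z \<in> verts G - {u, v}" for z
    using that by (auto simp: S'_def)
  have uvS': "u \<in> S' \<longleftrightarrow> w \<in> S" "v \<in> S' \<longleftrightarrow> w \<in> S" using uvS by (auto simp: S'_def)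
  have fin: "finite (edges G)" "finite (edges G1)" using bridgeless_cubicD(4)[OF G] by simp_all
  have E0eq: "crosses (ends G1 e) S = crosses (ends G e) S'" if e: "e \<in> E0" for e
  proof -
    have "e \<noteq> g" using e E0 by auto
    moreover have "ends G e \<subseteq> verts G - {u, v}"
      using E0_ends[OF e] e bridgeless_cubicD(1)[OF G] by (auto simp: E0_def multigraph_def)
    ultimately show ?thesis using mem unfolding crosses_def by auto
  qed
  have "card (cutset G1 S) = (\<Sum>e\<in>edges G1. of_bool (crosses (ends G1 e) S))"
    unfolding cutset_def by (rule card_filter[OF fin(2)])
  also have "\<dots> = of_bool ((w \<in> S) \<noteq> (w' \<in> S)) + (\<Sum>e\<in>E0. of_bool (crosses (ends G1 e) S))"
    unfolding edges_G1 using E0 by (simp del: sum_of_bool_eq)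
  also have "(\<Sum>e\<in>E0. of_bool (crosses (ends G1 e) S)) = (\<Sum>e\<in>E0. of_bool (crosses (ends G e) S') :: nat)"
    using E0eq by (intro sum.cong) simp_all
  also have "of_bool ((w \<in> S) \<noteq> (w' \<in> S)) + \<dots> = (\<Sum>e\<in>edges G. of_bool (crosses (ends G e) S'))"
    unfolding edges_G using E0 dist mem[OF verts_in(3)] mem[OF verts_in(4)] uvS'
    by (simp add: ends del: sum_of_bool_eq)
  also have "\<dots> = card (cutset G S')"
    unfolding cutset_def by (rule card_filter[OF fin(1), symmetric])
  finally have "card (cutset G1 S) = card (cutset G S')" .
  moreover have "S' \<subseteq> verts G" using S verts_in(1,2) by (auto simp: S'_def)
  ultimately show ?thesis using bridgeless_cubicD(5)[OF G] by simp
qed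

lemma bridgeless_cubic_G1: "bridgeless_cubic G1"
proof -
  have mg: "multigraph G" using bridgeless_cubicD(1)[OF G] .
  have "card (ends G1 e) = 2 \<and> ends G1 e \<subseteq> verts G1" if "e \<in> edges G1" for e
  proof -
    consider "e = g" | "e \<in> E0" using \<open>e \<in> edges G1\<close> unfolding edges_G1 by blast
    then show ?thesis
    proof cases
      case 2
      then have "e \<noteq> g" "e \<in> edges G" using E0 by (auto simp: E0_def)
      then show ?thesis using E0_ends[OF 2] mg by (auto simp: multigraph_def)
    qed (use ends_neq verts_in in auto)
  qed
  then have "multigraph G1" using bridgeless_cubicD(3,4)[OF G] by (simp add: multigraph_def)
  moreover have "degree G1 z = 3" if z: "z \<in> verts G1" for z
  proof -
    have fin: "finite (edges G)" "finite (edges G1)" using bridgeless_cubicD(4)[OF G] by simp_all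
    have "degree G1 z = (\<Sum>e\<in>edges G1. of_bool (z \<in> ends G1 e))"
      unfolding degree_def by (rule card_filter[OF fin(2)])
    also have "\<dots> = of_bool (z \<in> {w, w'}) + (\<Sum>e\<in>E0. of_bool (z \<in> ends G1 e))"
      unfolding edges_G1 using E0 by (simp del: sum_of_bool_eq)
    also have "(\<Sum>e\<in>E0. of_bool (z \<in> ends G1 e)) = (\<Sum>e\<in>E0. of_bool (z \<in> ends G e) :: nat)"
      using E0 by (intro sum.cong) (auto simp: E0_def)
    also have "of_bool (z \<in> {w, w'}) + \<dots> = (\<Sum>e\<in>edges G. of_bool (z \<in> ends G e))"
      unfolding edges_G using E0 dist z ends_neq by (auto simp add: ends simp del: sum_of_bool_eq)
    also have "\<dots> = card (incident G z)"
      unfolding incident_def by (rule card_filter[OF fin(1), symmetric])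
    finally show ?thesis using bridgeless_cubicD(6)[OF G] z by simp
  qed
  ultimately show ?thesis using cut_G1_neq_1 by (simp add: bridgeless_cubic_def cubic_def)
qed

lemma lift_coloring:
  assumes f: "edge_coloring G1 f"
  defines "f' \<equiv> f(k := f g)"
  shows "\<And>e. e \<in> edges G \<Longrightarrow> e \<notin> {h, h'} \<Longrightarrow> f' e < 11"
    "\<And>z. z \<in> verts G - {u, v} \<Longrightarrow> proper_at G f' z"
proof -
  have f11: "f e < 11" if "e \<in> edges G1" for e using f that by (simp add: edge_coloring_def)
  show "f' e < 11" if "e \<in> edges G" "e \<notin> {h, h'}" for e
    using that f11[of e] f11[of g] es dist by (auto simp: f'_def)
next
  define \<phi> where "\<phi> e = (if e = k then g else e)" for e
  fix z assume z: "z \<in> verts G - {u, v}"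
  have img: "\<phi> e \<in> incident G1 z" "f' e = f (\<phi> e)" if "e \<in> incident G z" for e
  proof -
    have e: "e \<in> edges G" "z \<in> ends G e" using that by (auto simp: incident_def)
    show "f' e = f (\<phi> e)" by (simp add: f'_def \<phi>_def)
    show "\<phi> e \<in> incident G1 z"
      using e z dist es ends by (cases "e = g") (auto simp: incident_def \<phi>_def)
  qed
  have inj: "e = e'" if "e \<in> incident G z" "e' \<in> incident G z" "\<phi> e = \<phi> e'" for e e'
  proof -
    have e: "z \<in> ends G e" "z \<in> ends G e'" using that by (auto simp: incident_def)
    show ?thesis
      using that(3) e z ends_neq ends dist by (auto simp: \<phi>_def split: if_splits)
  qed
  have "proper_at G1 f z" using f z by (simp add: edge_coloring_def)
  then show "proper_at G f' z"
    unfolding proper_at_def using img inj by metis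
qed

lemma lift_matching:
  assumes M: "perfect_matching G1 M" "g \<notin> M"
  shows "perfect_matching G (insert h M)"
proof -
  have ME: "M \<subseteq> E0" using M unfolding perfect_matching_def edges_G1 by blast
  have eq: "ends G1 e = ends G e" if "e \<in> M" for e
    using that M(2) by (intro G1_simps(4)) blast
  have hE: "ends G h \<inter> ends G e = {}" if "e \<in> M" for e
    using E0_ends[of e] that ME ends by auto
  show ?thesis
    unfolding perfect_matching_def
  proof (intro conjI ballI impI)
    show "insert h M \<subseteq> edges G" using ME es by (auto simp: E0_def)
    fix z assume "z \<in> verts G"
    then show "\<exists>e\<in>insert h M. z \<in> ends G e"
      using M(1) eq by (cases "z \<in> {u, v}") (auto simp: perfect_matching_def ends)
  next
    fix e e' assume e: "e \<in> insert h M" "e' \<in> insert h M" "ends G e \<inter> ends G e' \<noteq> {}"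
    show "e = e'"
    proof (cases "e = h \<or> e' = h")
      case True
      then show ?thesis using e hE by blast
    next
      case False
      then show ?thesis using e M(1) eq unfolding perfect_matching_def by (metis insertE)
    qed
  qed
qed

end

section \<open>Removing a component made of three parallel edges\<close>

definition remove_pair :: "('v, 'e) mgraph \<Rightarrow> 'v \<Rightarrow> 'v \<Rightarrow> ('v, 'e) mgraph" where
  "remove_pair G u v = \<lparr>verts = verts G - {u, v}, edges = edges G - incident G u, ends = ends G\<rparr>"

lemma remove_pair:
  assumes G: "bridgeless_cubic G" and uv: "u \<in> verts G" "v \<in> verts G" "u \<noteq> v"
    and inc: "incident G u = incident G v"
  shows "bridgeless_cubic (remove_pair G u v)" "e \<in> incident G u \<Longrightarrow> ends G e = {u, v}"
    "z \<in> verts G - {u, v} \<Longrightarrow> incident (remove_pair G u v) z = incident G z"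
proof -
  define H where "H = remove_pair G u v"
  have H: "verts H = verts G - {u, v}" "edges H = edges G - incident G u" "ends H = ends G"
    by (auto simp: H_def remove_pair_def)
  have mg: "multigraph G" using bridgeless_cubicD(1)[OF G] .
  have inc_in: "ends G e = {u, v}" if "e \<in> incident G u" for e
  proof -
    have "e \<in> edges G" "u \<in> ends G e" using that by (auto simp: incident_def)
    then obtain t where "ends G e = {u, t}" using multigraph_ends[OF mg] by metis
    moreover have "v \<in> ends G e" using that inc by (auto simp: incident_def)
    ultimately show ?thesis using uv by auto
  qed
  then show "e \<in> incident G u \<Longrightarrow> ends G e = {u, v}" .
  have "ends G e \<subseteq> verts G - {u, v}" if "e \<in> edges H" for e
  proof -
    have "e \<notin> incident G u" "e \<notin> incident G v" "e \<in> edges G" using that inc H by auto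
    then show ?thesis using mg by (auto simp: multigraph_def incident_def)
  qed
  then have "multigraph H" using mg by (simp add: multigraph_def H)
  moreover have "incident H z = incident G z" if "z \<in> verts G - {u, v}" for z
  proof -
    have "e \<notin> incident G u" if "z \<in> ends G e" for e
      using that inc_in \<open>z \<in> verts G - {u, v}\<close> by auto
    then show ?thesis by (auto simp: incident_def[of _ z] H)
  qed
  moreover have "card (cutset H S) \<noteq> 1" if "S \<subseteq> verts H" for S
  proof -
    have S: "S \<subseteq> verts G" "u \<notin> S" "v \<notin> S" using that by (auto simp: H)
    have "e \<notin> incident G u" if "crosses (ends G e) S" for e
      using that inc_in[of e] S by auto
    then have "cutset H S = cutset G S" by (auto simp: cutset_def H)
    then show ?thesis using bridgeless_cubicD(5)[OF G S(1)] by simp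
  qed
  ultimately show "bridgeless_cubic (remove_pair G u v)"
    "z \<in> verts G - {u, v} \<Longrightarrow> incident (remove_pair G u v) z = incident G z"
    using bridgeless_cubicD(6)[OF G] unfolding H_def[symmetric] bridgeless_cubic_def cubic_def
    by (auto simp: degree_def incident_def[symmetric] H(1))
qed

text \<open>The reduction is performed at an edge \<open>xy\<close> such that \<open>x\<close> is adjacent to an end \<open>b\<close> of
  the prescribed edge. The matching of the reduced graph then avoids the new edge at \<open>b\<close>.\<close>

theorem perfect_matching_through:
  fixes G :: "('v, 'e) mgraph"
  assumes "bridgeless_cubic G" "e \<in> edges G"
  shows "\<exists>M. perfect_matching G M \<and> e \<in> M"
  using assms
proof (induction "card (verts G)" arbitrary: G e rule: less_induct)
  case less
  note G = less.prems(1) and eG = less.prems(2)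
  have mg: "multigraph G" using bridgeless_cubicD(1)[OF G] .
  obtain b b' where b: "ends G e = {b, b'}" "b' \<noteq> b" "b \<in> verts G" "b' \<in> verts G"
    using multigraph_obtain_ends[OF mg eG] .
  have smaller: "card (verts G - {p, q}) < card (verts G)" if "p \<in> verts G" for p q
    using bridgeless_cubicD(3)[OF G] that by (intro psubset_card_mono) auto
  have IH: "\<exists>M. perfect_matching H M \<and> e \<in> M"
    if "bridgeless_cubic H" "e \<in> edges H" "verts H = verts G - {p, q}" "p \<in> verts G"
    for H :: "('v, 'e) mgraph" and p q e
    using less.hyps[of H e] that smaller by simp
  show ?case
  \<comment> \<open>In the exceptional case \<open>b\<close> and \<open>b'\<close> are joined by
    three parallel edges and form a component; any perfect matching of the rest is completed by
    \<open>e\<close>.\<close>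
  proof (cases "incident G b \<subseteq> incident G b'")
    case True
    then have inc: "incident G b = incident G b'"
      using bridgeless_cubicD(4,6)[OF G] b by (intro card_subset_eq) (auto simp: incident_def)
    note rp = remove_pair[OF G b(3,4) b(2)[symmetric] inc]
    define H where "H = remove_pair G b b'"
    have H: "verts H = verts G - {b, b'}" "edges H = edges G - incident G b" "ends H = ends G"
      by (auto simp: H_def remove_pair_def)
    have bc: "bridgeless_cubic H" using rp(1) by (simp add: H_def)
    have "\<exists>M. perfect_matching H M"
    proof (cases "edges H = {}")
      case True
      then have "verts H = {}"
        using bridgeless_cubicD(6)[OF bc] by (auto simp: incident_def)
      then show ?thesis using True by (intro exI[of _ "{}"]) (simp add: perfect_matching_def)
    next
      case False
      then show ?thesis using IH[OF bc _ H(1) b(3)] by blast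
    qed
    then obtain M where M: "perfect_matching H M" by blast
    have disj: "ends G e \<inter> ends G e' = {}" if "e' \<in> M" for e'
    proof -
      have "e' \<in> edges H" using that M by (auto simp: perfect_matching_def)
      then have "e' \<in> edges G" "e' \<notin> incident G b" "e' \<notin> incident G b'" using inc H by auto
      then show ?thesis using b by (auto simp: incident_def)
    qed
    have "perfect_matching G (insert e M)"
      unfolding perfect_matching_def
    proof (intro conjI ballI impI)
      show "insert e M \<subseteq> edges G" using M eG H by (auto simp: perfect_matching_def)
      fix z assume "z \<in> verts G"
      then show "\<exists>e\<in>insert e M. z \<in> ends G e"
        using M H b by (cases "z \<in> {b, b'}") (auto simp: perfect_matching_def)
    next
      fix e1 e2 assume "e1 \<in> insert e M" "e2 \<in> insert e M" "ends G e1 \<inter> ends G e2 \<noteq> {}"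
      then show "e1 = e2" using M disj H(3) unfolding perfect_matching_def by (metis Int_commute insertE)
    qed
    then show ?thesis by blast
  next
    case False
    then obtain g where g: "g \<in> edges G" "b \<in> ends G g" "b' \<notin> ends G g"
      by (auto simp: incident_def)
    then have ge: "g \<noteq> e" using b by auto
    obtain x where x: "ends G g = {b, x}" "x \<noteq> b" "x \<in> verts G"
      using multigraph_ends[OF mg g(1,2)] by metis
    have xb': "x \<noteq> b'" using g x by auto
    obtain h1 h2 where incx: "incident G x = {g, h1, h2}" "distinct [g, h1, h2]"
      using incident3[OF G x(3) g(1)] x by blast
    have h12: "h1 \<in> edges G" "x \<in> ends G h1" "h2 \<in> edges G" "x \<in> ends G h2"
      using incx by (auto simp: incident_def)
    \<comment> \<open>The edge \<open>e\<close> has to survive the removal of \<open>x\<close> and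
      \<open>y\<close>, so the other end \<open>y\<close> of \<open>h\<close> must avoid
      \<open>b\<close> and \<open>b'\<close>. If both candidates failed, \<open>b\<close>,
      \<open>b'\<close>, \<open>x\<close> would span four edges.\<close>
    have "\<exists>h h'. {h, h'} = {h1, h2} \<and> h \<noteq> h' \<and> \<not> ends G h \<subseteq> {b, b', x}"
    proof (rule ccontr)
      assume neg: "\<not> ?thesis"
      have "ends G h1 \<subseteq> {b, b', x}" "ends G h2 \<subseteq> {b, b', x}"
        using neg incx(2) by (auto simp del: insert_subset)
      moreover have "e \<notin> {h1, h2}" using b h12 x xb' by auto
      ultimately have "{e, g, h1, h2} \<subseteq> {e \<in> edges G. ends G e \<subseteq> {b, b', x}}"
        "card {e, g, h1, h2} \<ge> 4"
        using eG g h12 b x incx(2) ge by auto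
      moreover have "card {b, b', x} = 3" using b x xb' by auto
      moreover have "{b, b', x} \<subseteq> verts G" using b x by auto
      ultimately show False using no_dense_triple[OF G] by metis
    qed
    then obtain h h' where hh: "{h, h'} = {h1, h2}" "h \<noteq> h'" "\<not> ends G h \<subseteq> {b, b', x}" by blast
    have incx': "incident G x = {g, h, h'}" "distinct [g, h, h']"
      using incx hh by (auto simp: doubleton_eq_iff)
    have h: "h \<in> edges G" "x \<in> ends G h" "h' \<in> edges G" "x \<in> ends G h'"
      using incx' by (auto simp: incident_def)
    obtain y where y: "ends G h = {x, y}" "y \<noteq> x" "y \<in> verts G"
      using multigraph_ends[OF mg h(1,2)] by metis
    have yb: "y \<noteq> b" "y \<noteq> b'" using y hh(3) by auto
    obtain a where a: "ends G h' = {x, a}" "a \<noteq> x" "a \<in> verts G"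
      using multigraph_ends[OF mg h(3,4)] by metis
    have eh: "e \<noteq> h" "e \<noteq> h'" "e \<noteq> g" using ge b x xb' y a by auto
    show ?thesis
    \<comment> \<open>If \<open>a = y\<close>, the edges \<open>h\<close> and \<open>h'\<close> are
      parallel and the digon is suppressed instead. Its new edge again ends at \<open>b\<close>, so
      a matching through \<open>e\<close> omits it.\<close>
    proof (cases "a = y")
      case True
      obtain k where k: "incident G y = {h, h', k}" "distinct [h, h', k]"
        using incident_third[OF G y(3) h(1) _ h(3)] y a True hh(2) by blast
      have kG: "k \<in> edges G" "y \<in> ends G k" using k by (auto simp: incident_def)
      obtain w' where w': "ends G k = {y, w'}" "w' \<noteq> y" "w' \<in> verts G"
        using multigraph_ends[OF mg kG] by metis
      have kg: "k \<noteq> g" using kG x y yb by auto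
      have "k \<notin> incident G x" using incx' k kg by auto
      then have "w' \<noteq> x" using kG w' by (auto simp: incident_def)
      interpret digon G x y h h' g k b w'
        using G h g kG y a x w' k incx' True kg yb \<open>w' \<noteq> x\<close>
        by unfold_locales (auto simp: insert_commute)
      have ek: "e \<noteq> k" using kG b yb by auto
      have "e \<in> edges G1" using eG eh ek by simp
      then obtain M where M: "perfect_matching G1 M" "e \<in> M"
        using IH[OF bridgeless_cubic_G1 _ G1_simps(1) x(3)] by blast
      have "b \<in> ends G1 g \<inter> ends G1 e" using eh b by simp
      then have "g \<notin> M" using M eh unfolding perfect_matching_def by blast
      then show ?thesis using lift_matching[OF M(1)] M(2) by blast
    next
      case False
      obtain e3 e4 where incy: "incident G y = {h, e3, e4}" "distinct [h, e3, e4]"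
        using incident3[OF G y(3) h(1)] y by blast
      have e34: "e3 \<in> edges G" "y \<in> ends G e3" "e4 \<in> edges G" "y \<in> ends G e4"
        using incy by (auto simp: incident_def)
      obtain c where c: "ends G e3 = {y, c}" "c \<noteq> y" "c \<in> verts G"
        using multigraph_ends[OF mg e34(1,2)] by metis
      obtain d where d: "ends G e4 = {y, d}" "d \<noteq> y" "d \<in> verts G"
        using multigraph_ends[OF mg e34(3,4)] by metis
      have ne: "e3 \<noteq> g" "e4 \<noteq> g" "e3 \<noteq> h'" "e4 \<noteq> h'" "e3 \<noteq> e" "e4 \<noteq> e"
        using e34 x y yb a b False by auto
      have "e3 \<notin> incident G x" "e4 \<notin> incident G x" using incx' incy ne by auto
      then have cd: "c \<noteq> x" "d \<noteq> x" using e34 c d by (auto simp: incident_def)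
      have split: "split_edge G x y h h' g e3 e4 a b c d"
        using G h g e34 y a x c d cd incx' incy ne False yb
        by unfold_locales (auto simp: insert_commute)
      have main: ?thesis
        if split': "split_edge G x y h h' g e3 e4 a b c d"
          and bc: "bridgeless_cubic (split_edge.G1 G x y h h' g e3 e4 a b c d)"
          and ne': "e \<noteq> e3" "e \<noteq> e4" for e3 e4 c d
      proof -
        interpret split_edge G x y h h' g e3 e4 a b c d by (rule split')
        have "e \<in> edges G1" using eG eh ne' by simp
        then obtain M where M: "perfect_matching G1 M" "e \<in> M"
          using IH[OF bc _ G1_simps(1) x(3)] by blast
        have "b \<in> ends G1 g \<inter> ends G1 e" using eh b by simp
        then have "g \<notin> M" using M eh unfolding perfect_matching_def by blast
        then show ?thesis
          using lift_matching[OF bridgeless_cubicD(1)[OF bc] M(1)] M(2) by blast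
      qed
      show ?thesis
        using frink[OF split] main[OF split] main[OF split_edge.swap[OF split]] ne by blast
    qed
  qed
qed

section \<open>Colouring the cycles of a 2-factor\<close>

lemma far_sym: "far a b \<longleftrightarrow> far b a"
  by (auto simp: far_def)

text \<open>The iterates below the least power are distinct, so a sequence indexed by them is a
  function on the orbit; the remainder closes the cycle.\<close>

lemma ex_along_orbit:
  assumes s: "permutation s"
    and y: "\<And>i. i < least_power s v \<Longrightarrow> P ((s ^^ i) v) (y i) (y (Suc i mod least_power s v))"
  shows "\<exists>x. \<forall>u\<in>orb s v. P u (x u) (x (s u))"
proof -
  define l where "l = least_power s v"
  have l: "l > 0" "(s ^^ l) v = v"
    using least_power_of_permutation[OF s] by (auto simp: l_def)
  have "distinct (map (\<lambda>i. (s ^^ i) v) [0..<l])"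
    using cycle_of_permutation[OF s, of v] by (simp add: l_def)
  then have inj: "inj_on (\<lambda>i. (s ^^ i) v) {0..<l}"
    by (simp add: distinct_map)
  define x where "x = (\<lambda>u. y (the_inv_into {0..<l} (\<lambda>i. (s ^^ i) v) u))"
  have x: "x ((s ^^ i) v) = y i" if "i < l" for i
    using the_inv_into_f_f[OF inj, of i] that by (simp add: x_def)
  have "P u (x u) (x (s u))" if "u \<in> orb s v" for u
  proof -
    have "u \<in> set (map (\<lambda>i. (s ^^ i) v) [0..<l])"
      using that support_set[OF s, of v] by (simp add: orb_def l_def)
    then obtain i where i: "i < l" "u = (s ^^ i) v" by auto
    have "x (s u) = y (Suc i mod l)"
    proof (cases "Suc i = l")
      case True
      have "s u = (s ^^ Suc i) v" by (simp add: i)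
      then have "s u = (s ^^ 0) v" using l True by simp
      then show ?thesis using x[of 0] l True by simp
    next
      case False
      then have "Suc i < l" using i by simp
      then show ?thesis using x[of "Suc i"] i by simp
    qed
    then show ?thesis using x[OF i(1)] y[of i] i by (simp add: l_def)
  qed
  then show ?thesis by blast
qed

text \<open>A switch between low and high colours takes place in the middle of the window, and
  the colours 5 and 8 alternate on the rest of the orbit.\<close>

lemma ex_window_colors:
  assumes T: "\<And>i. T i \<le> (2::nat)" and l: "odd l" "5 \<le> l"
    and win: "max (T 0) (T 1) < min (T 2) (T 3) \<or> max (T 2) (T 3) < min (T 0) (T 1)"
  shows "\<exists>y. \<forall>i<l. y i < 11 \<and> far (y i) (T i) \<and> far (y i) (T (Suc i)) \<and> far (y i) (y (Suc i mod l))"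
proof -
  \<comment> \<open>Index \<open>i\<close> stands for the cycle edge from vertex \<open>i\<close> to
    vertex \<open>i + 1\<close>, so it meets the matching colours \<open>T i\<close> and
    \<open>T (Suc i)\<close>, and edges 0, 1, 2 lie inside the window. Since 13 = 5 + 8,
    \<open>13 - d\<close> is the other of the two alternating colours; as \<open>l\<close> is odd,
    the last index is even, so \<open>13 - d\<close> closes up with \<open>a\<close>.\<close>
  define z where "z a b c d = (\<lambda>i::nat. if i = 0 then a else if i = 1 then b else if i = 2 then c
      else if odd i then d else 13 - d)" for a b c d :: nat
  have tail: "far 5 (T i)" "far 8 (T i)" for i
    using T[of i] by (auto simp: far_def)
  have Suc_mod: "Suc i mod l = (if Suc i = l then 0 else Suc i)" if "i < l" for i
    using that by auto
  have gen: "\<exists>y. \<forall>i<l. y i < 11 \<and> far (y i) (T i) \<and> far (y i) (T (Suc i)) \<and> far (y i) (y (Suc i mod l))"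
    if c: "a < 11" "b < 11" "c < 11" "d = 5 \<or> d = 8" "far a b" "far b c" "far c d" "far (13 - d) a"
      "far a (T 0)" "far a (T 1)" "far b (T 1)" "far b (T 2)" "far c (T 2)" "far c (T 3)"
    for a b c d
  proof (intro exI allI impI)
    fix i assume i: "i < l"
    consider "i = 0" | "i = 1" | "i = 2" | "3 \<le> i" by linarith
    then show "z a b c d i < 11 \<and> far (z a b c d i) (T i) \<and> far (z a b c d i) (T (Suc i)) \<and>
        far (z a b c d i) (z a b c d (Suc i mod l))"
    proof cases
      case 4
      have "even i" if "Suc i = l" using that l by auto
      then show ?thesis using 4 c tail by (auto simp: z_def Suc_mod[OF i]) (auto simp: far_def)
    qed (use c l in \<open>auto simp: z_def Suc_mod[OF i] simp flip: numeral_2_eq_2\<close>)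
  qed
  note T4 = T[of 0] T[of 1] T[of 2] T[of 3]
  consider "T 0 < T 2" "T 0 < T 3" "T 1 < T 2" "T 1 < T 3"
    | "T 2 < T 0" "T 3 < T 0" "T 2 < T 1" "T 3 < T 1"
    using win by auto
  then show ?thesis
  proof cases
    case 1
    show ?thesis
    \<comment> \<open>Among the matching colours 0, 1, 2, the colour 3 tolerates only 0, 4 only 0
      and 1, 9 only 1 and 2, and 10 only 2. So 3, 6, 9 fits a low side equal to 0 and 4, 7, 10 fits
      a high side equal to 2; strict separation leaves no other case. The reversed window takes the
      same colours backwards.\<close>
    proof (cases "T 0 = 0 \<and> T 1 = 0")
      case True
      show ?thesis by (rule gen[of 3 6 9 5]) (use 1 True T4 in \<open>auto simp: far_def\<close>)
    next
      case False
      then have "T 2 = 2" "T 3 = 2" using 1 T4 by linarith+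
      then show ?thesis by (intro gen[of 4 7 10 5]) (use 1 T4 in \<open>auto simp: far_def\<close>)
    qed
  next
    case 2
    show ?thesis
    proof (cases "T 2 = 0 \<and> T 3 = 0")
      case True
      show ?thesis by (rule gen[of 9 6 3 8]) (use 2 True T4 in \<open>auto simp: far_def\<close>)
    next
      case False
      then have "T 0 = 2" "T 1 = 2" using 2 T4 by linarith+
      then show ?thesis by (intro gen[of 10 7 4 8]) (use 2 T4 in \<open>auto simp: far_def\<close>)
    qed
  qed
qed

context matched_perm
begin

text \<open>\<open>x v\<close> is the colour of the cycle edge from \<open>v\<close> to
  \<open>s v\<close>, and \<open>t v\<close> that of the matching edge at \<open>v\<close>. Once
  \<open>t\<close> is fixed the orbits are independent; \<open>X\<close> is indexed by the orbit so
  that all its vertices use the same choice.\<close>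

theorem ex_colors:
  "\<exists>t x. (\<forall>v. t v < 11) \<and> (\<forall>v\<in>V. t (\<mu> v) = t v) \<and>
     (\<forall>v\<in>V. x v < 11 \<and> far (x v) (t v) \<and> far (x v) (t (s v)) \<and> far (x v) (x (s v)))"
proof -
  obtain t where t: "\<And>v. t v \<le> 2" "\<And>v. v \<in> V \<Longrightarrow> t (\<mu> v) = t v"
    "\<And>D. D \<in> odd_orbs \<Longrightarrow> \<exists>v\<in>D. window t v"
    using ex_windows by blast
  define P where "P u a b \<longleftrightarrow> a < 11 \<and> far a (t u) \<and> far a (t (s u)) \<and> far a b" for u a b
  have ex: "\<exists>x. \<forall>u\<in>orb s v. P u (x u) (x (s u))" if "v \<in> V" for v
  proof (cases "odd (least_power s v)")
    case True
    then have "orb s v \<in> odd_orbs" using that by (auto simp: odd_orbs_def)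
    then obtain u where u: "u \<in> orb s v" "window t u" using t(3) by blast
    define T where "T i = t ((s ^^ i) u)" for i
    have "\<exists>y. \<forall>i<least_power s u. y i < 11 \<and> far (y i) (T i) \<and> far (y i) (T (Suc i)) \<and>
        far (y i) (y (Suc i mod least_power s u))"
    proof (rule ex_window_colors)
      show "T i \<le> 2" for i by (simp add: T_def t(1))
      show "odd (least_power s u)" "5 \<le> least_power s u"
        using least_power_orb[OF perm u(1)] True odd_long[OF that True] by simp_all
      show "max (T 0) (T 1) < min (T 2) (T 3) \<or> max (T 2) (T 3) < min (T 0) (T 1)"
        using u(2) by (simp add: T_def window_def numeral_2_eq_2 numeral_3_eq_3)
    qed
    then obtain y where "\<And>i. i < least_power s u \<Longrightarrow>
        P ((s ^^ i) u) (y i) (y (Suc i mod least_power s u))"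
      by (auto simp: P_def T_def)
    from ex_along_orbit[of s u P y, OF perm this] show ?thesis using orb_eq[OF perm u(1)] by simp
  next
    case False
    have tail: "far 5 (t u)" "far 8 (t u)" for u
      using t(1)[of u] by (auto simp: far_def)
    show ?thesis
    proof (rule ex_along_orbit[OF perm, where y = "\<lambda>i. if even i then 5 else 8"])
      fix i assume "i < least_power s v"
      have "even (Suc i mod least_power s v) = even (Suc i)"
        using False by (metis dvd_mod_iff)
      then show "P ((s ^^ i) v) (if even i then 5 else 8)
          (if even (Suc i mod least_power s v) then 5 else 8)"
        using tail by (simp add: P_def) (simp add: far_def)
    qed
  qed
  define X where "X D = (SOME x. \<forall>u\<in>D. P u (x u) (x (s u)))" for D :: "'v set"
  have X: "\<forall>u\<in>orb s v. P u (X (orb s v) u) (X (orb s v) (s u))" if "v \<in> V" for v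
    unfolding X_def using ex[OF that] by (rule someI_ex)
  define x where "x v = X (orb s v) v" for v
  have "P v (x v) (x (s v))" if "v \<in> V" for v
    using X[OF that] orb_self[of v s] orb_eq[OF perm orb_step[OF orb_self[of v s]]]
    by (simp add: x_def)
  moreover have "t v < 11" for v using t(1)[of v] by simp
  ultimately show ?thesis using t(2) unfolding P_def by blast
qed

end

text \<open>With at most two edges at each vertex, the components are paths and cycles and can be
  directed consistently. In the induction, two edges \<open>va\<close> and \<open>vb\<close> are
  merged into one edge \<open>ab\<close>, whose direction is then given to the path through
  \<open>v\<close>; two parallel edges are directed as a cycle of their own.\<close>

lemma orientation:
  fixes ends :: "'e \<Rightarrow> 'v set"
  assumes "finite F" "\<And>e. e \<in> F \<Longrightarrow> card (ends e) = 2"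
    "\<And>v e1 e2 e3. {e1, e2, e3} \<subseteq> F \<Longrightarrow> v \<in> ends e1 \<inter> ends e2 \<inter> ends e3 \<Longrightarrow> \<not> distinct [e1, e2, e3]"
  shows "\<exists>tl hd. (\<forall>e\<in>F. ends e = {tl e, hd e}) \<and> inj_on tl F \<and> inj_on hd F"
  using assms
proof (induction "card F" arbitrary: F ends rule: less_induct)
  case less
  note fin = less.prems(1) and two = less.prems(2) and deg = less.prems(3)
  have pair: "\<exists>w. ends e = {v, w} \<and> w \<noteq> v" if "e \<in> F" "v \<in> ends e" for e v
    using two[OF that(1)] that(2) by (auto simp: card_2_iff)
  show ?case
  proof (cases "\<exists>v e e'. e \<in> F \<and> e' \<in> F \<and> e \<noteq> e' \<and> v \<in> ends e \<and> v \<in> ends e'")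
    case False
    define tl where "tl e = (SOME v. v \<in> ends e)" for e
    have tl: "tl e \<in> ends e" if "e \<in> F" for e
    proof -
      have "ends e \<noteq> {}" using two[OF that] by auto
      then show ?thesis unfolding tl_def by (auto intro: someI)
    qed
    have "\<forall>e\<in>F. \<exists>w. ends e = {tl e, w}" using pair tl by blast
    from bchoice[OF this] obtain hd where hd: "\<And>e. e \<in> F \<Longrightarrow> ends e = {tl e, hd e}" by blast
    have "inj_on tl F" "inj_on hd F" using False hd by (auto simp: inj_on_def)
    then show ?thesis using hd by blast
  next
    case True
    then obtain v e e' where e: "e \<in> F" "e' \<in> F" "e \<noteq> e'" "v \<in> ends e" "v \<in> ends e'" by blast
    obtain a where a: "ends e = {v, a}" "a \<noteq> v" using pair e by blast
    obtain b where b: "ends e' = {v, b}" "b \<noteq> v" using pair e by blast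
    have third: "v \<notin> ends f" if "f \<in> F" "f \<noteq> e" "f \<noteq> e'" for f
      using deg[of e e' f v] that e by auto
    show ?thesis
    proof (cases "a = b")
      case True
      have third_a: "a \<notin> ends f" if "f \<in> F" "f \<noteq> e" "f \<noteq> e'" for f
        using deg[of e e' f a] that e a b True by auto
      have "\<exists>tl hd. (\<forall>f\<in>F - {e, e'}. ends f = {tl f, hd f}) \<and> inj_on tl (F - {e, e'}) \<and> inj_on hd (F - {e, e'})"
      proof (rule less.hyps)
        show "card (F - {e, e'}) < card F" using fin e by (intro psubset_card_mono) auto
      qed (use fin two deg in auto)
      then obtain tl hd where th: "\<And>f. f \<in> F - {e, e'} \<Longrightarrow> ends f = {tl f, hd f}"
        "inj_on tl (F - {e, e'})" "inj_on hd (F - {e, e'})" by blast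
      have ne: "tl f \<noteq> v" "tl f \<noteq> a" "hd f \<noteq> v" "hd f \<noteq> a" if "f \<in> F" "f \<noteq> e" "f \<noteq> e'" for f
        using th(1)[of f] third[OF that] third_a[OF that] that by auto
      have inj: "inj_on (p(e := i, e' := j)) F"
        if "inj_on p (F - {e, e'})" "\<And>f. f \<in> F \<Longrightarrow> f \<noteq> e \<Longrightarrow> f \<noteq> e' \<Longrightarrow> p f \<noteq> i \<and> p f \<noteq> j" "i \<noteq> j"
        for p i j
      proof (rule inj_onI)
        fix f f' assume ff: "f \<in> F" "f' \<in> F" "(p(e := i, e' := j)) f = (p(e := i, e' := j)) f'"
        show "f = f'"
          using ff that(2)[OF ff(1)] that(2)[OF ff(2)] that(3) inj_onD[OF that(1), of f f']
          by (auto split: if_splits)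
      qed
      have "inj_on (tl(e := v, e' := a)) F" "inj_on (hd(e := a, e' := v)) F"
        using inj[of tl v a] inj[of hd a v] th(2,3) ne a by blast+
      moreover have "ends f = {(tl(e := v, e' := a)) f, (hd(e := a, e' := v)) f}" if "f \<in> F" for f
        using th(1)[of f] that a b True e(3) by auto
      ultimately show ?thesis by blast
    next
      case False
      define ends' where "ends' = ends(e := {a, b})"
      have "\<exists>tl hd. (\<forall>f\<in>F - {e'}. ends' f = {tl f, hd f}) \<and> inj_on tl (F - {e'}) \<and> inj_on hd (F - {e'})"
      proof (rule less.hyps)
        show "card (F - {e'}) < card F" using fin e by (intro psubset_card_mono) auto
        show "finite (F - {e'})" using fin by simp
        show "card (ends' f) = 2" if "f \<in> F - {e'}" for f
          using that two False by (auto simp: ends'_def)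
        fix z f1 f2 f3
        assume f: "{f1, f2, f3} \<subseteq> F - {e'}" "z \<in> ends' f1 \<inter> ends' f2 \<inter> ends' f3"
        \<comment> \<open>At \<open>b\<close> the merged edge stands for \<open>e'\<close>,
          elsewhere for \<open>e\<close>, so three edges meeting in the merged graph give three
          edges meeting in the original one.\<close>
        define \<phi> where "\<phi> f = (if f = e \<and> z = b then e' else f)" for f
        have "{\<phi> f1, \<phi> f2, \<phi> f3} \<subseteq> F" using f(1) e by (auto simp: \<phi>_def)
        moreover have "z \<in> ends (\<phi> f)" if "z \<in> ends' f" for f
          using that a b by (auto simp: \<phi>_def ends'_def split: if_splits)
        ultimately have "\<not> distinct [\<phi> f1, \<phi> f2, \<phi> f3]"
          using deg[of "\<phi> f1" "\<phi> f2" "\<phi> f3" z] f(2) by blast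
        then show "\<not> distinct [f1, f2, f3]"
          using f(1) by (auto simp: \<phi>_def split: if_splits)
      qed
      then obtain tl hd where th: "\<And>f. f \<in> F - {e'} \<Longrightarrow> ends' f = {tl f, hd f}"
        "inj_on tl (F - {e'})" "inj_on hd (F - {e'})" by blast
      \<comment> \<open>The merged edge may point either way. The claim is proved for tail
        \<open>a\<close>, and reversing all edges covers the other case.\<close>
      have goal: "\<exists>p' q'. (\<forall>f\<in>F. ends f = {p' f, q' f}) \<and> inj_on p' F \<and> inj_on q' F"
        if pq: "\<And>f. f \<in> F - {e'} \<Longrightarrow> ends' f = {p f, q f}"
          "inj_on p (F - {e'})" "inj_on q (F - {e'})" "p e = a" "q e = b" for p q
      proof -
        have pq_ends: "ends f = {p f, q f}" if "f \<in> F" "f \<noteq> e" "f \<noteq> e'" for f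
          using pq(1)[of f] that by (auto simp: ends'_def)
        then have ne: "p f \<noteq> v" "q f \<noteq> v" if "f \<in> F" "f \<noteq> e" "f \<noteq> e'" for f
          using third[OF that] that by auto
        have ne2: "q f \<noteq> b" if "f \<in> F" "f \<noteq> e" "f \<noteq> e'" for f
          using pq(3,5) that e unfolding inj_on_def by blast
        have inj_p: "f = f'" if "f \<in> F" "f' \<in> F" "f \<noteq> e'" "f' \<noteq> e'" "p f = p f'" for f f'
          using inj_onD[OF pq(2) that(5)] that by blast
        have inj_q: "f = f'" if "f \<in> F" "f' \<in> F" "f \<noteq> e'" "f' \<noteq> e'" "q f = q f'" for f f'
          using inj_onD[OF pq(3) that(5)] that by blast
        have "inj_on (p(e' := v)) F"
        proof (rule inj_onI)
          fix f f' assume ff: "f \<in> F" "f' \<in> F" "(p(e' := v)) f = (p(e' := v)) f'"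
          have "p f \<noteq> v" if "f \<in> F" "f \<noteq> e'" for f
            using ne(1)[OF that(1)] that pq(4) a(2) by (cases "f = e") auto
          then show "f = f'"
            using ff inj_p[OF ff(1,2)] by (auto split: if_splits)
        qed
        moreover have "inj_on (q(e := v, e' := b)) F"
        proof (rule inj_onI)
          fix f f' assume ff: "f \<in> F" "f' \<in> F" "(q(e := v, e' := b)) f = (q(e := v, e' := b)) f'"
          show "f = f'"
            using ff inj_q[OF ff(1,2)] ne(2)[OF ff(1)] ne(2)[OF ff(2)] ne2[OF ff(1)] ne2[OF ff(2)] b(2)
            by (auto split: if_splits)
        qed
        moreover have "ends f = {(p(e' := v)) f, (q(e := v, e' := b)) f}" if "f \<in> F" for f
          using pq_ends[of f] that a b pq(4) e(3) by auto
        ultimately show ?thesis by blast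
      qed
      have "{tl e, hd e} = {a, b}" using th(1)[of e] e by (simp add: ends'_def)
      then consider "tl e = a" "hd e = b" | "hd e = a" "tl e = b" by (auto simp: doubleton_eq_iff)
      then show ?thesis
      proof cases
        case 1
        then show ?thesis using goal[of tl hd] th by blast
      next
        case 2
        have "ends' f = {hd f, tl f}" if "f \<in> F - {e'}" for f using th(1)[OF that] by auto
        then obtain p q where "\<forall>f\<in>F. ends f = {p f, q f}" "inj_on p F" "inj_on q F"
          using goal[of hd tl] th 2 by blast
        then show ?thesis by (intro exI[of _ q] exI[of _ p]) auto
      qed
    qed
  qed
qed

definition adj :: "('v, 'e) mgraph \<Rightarrow> 'v \<Rightarrow> 'v \<Rightarrow> bool" where
  "adj G x y \<longleftrightarrow> (\<exists>e\<in>edges G. ends G e = {x, y})"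

lemma adj_sym: "adj G x y \<longleftrightarrow> adj G y x"
  by (simp add: adj_def insert_commute)

text \<open>The complement of a perfect matching is oriented to yield the permutation
  \<open>s\<close>. An odd orbit of length 3 or a chord over two steps would be a triangle, a chord
  over three steps a 4-cycle, so the excluded configurations are just those that
  \<open>matched_perm\<close> forbids.\<close>

theorem coloring_girth5:
  fixes G :: "('v, 'e) mgraph"
  assumes G: "bridgeless_cubic G"
    and no3: "\<And>x y z. distinct [x, y, z] \<Longrightarrow> adj G x y \<Longrightarrow> adj G y z \<Longrightarrow> \<not> adj G z x"
    and no4: "\<And>x y z w. distinct [x, y, z, w] \<Longrightarrow> adj G x y \<Longrightarrow> adj G y z \<Longrightarrow> adj G z w \<Longrightarrow> \<not> adj G w x"
  shows "\<exists>f. edge_coloring G f"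
proof (cases "edges G = {}")
  case True
  then show ?thesis by (simp add: edge_coloring_def proper_at_def incident_def)
next
  case False
  have mg: "multigraph G" and finV: "finite (verts G)" using bridgeless_cubicD[OF G] by auto
  let ?V = "verts G"
  obtain M where M: "perfect_matching G M"
    using False perfect_matching_through[OF G] by blast
  define F where "F = edges G - M"
  have ME: "M \<subseteq> edges G" using M by (simp add: perfect_matching_def)
  obtain m where m: "\<And>v. v \<in> ?V \<Longrightarrow> m v \<in> M \<and> v \<in> ends G (m v)"
    using M unfolding perfect_matching_def by metis
  have m_unique: "e = m v" if "e \<in> M" "v \<in> ends G e" "v \<in> ?V" for e v
    using M that m[OF that(3)] unfolding perfect_matching_def by blast
  have F2: "card (incident G v - {m v}) = 2" if "v \<in> ?V" for v
    using bridgeless_cubicD(6)[OF G that] m[OF that] ME by (subst card_Diff_singleton) (auto simp: incident_def)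
  have ends_V: "ends G e \<subseteq> ?V" if "e \<in> edges G" for e
    using mg that by (simp add: multigraph_def)
  have F_inc: "e \<in> incident G v - {m v}" if "e \<in> F" "v \<in> ends G e" for e v
    using that m[of v] ends_V[of e] by (auto simp: F_def incident_def)
  have "\<exists>tl hd. (\<forall>e\<in>F. ends G e = {tl e, hd e}) \<and> inj_on tl F \<and> inj_on hd F"
  proof (rule orientation)
    show "finite F" using bridgeless_cubicD(4)[OF G] by (simp add: F_def)
    show "card (ends G e) = 2" if "e \<in> F" for e
      using that mg by (simp add: F_def multigraph_def)
    fix v e1 e2 e3 assume e: "{e1, e2, e3} \<subseteq> F" "v \<in> ends G e1 \<inter> ends G e2 \<inter> ends G e3"
    have v: "v \<in> ?V" using e ends_V[of e1] by (auto simp: F_def)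
    have "{e1, e2, e3} \<subseteq> incident G v - {m v}" using e F_inc by blast
    moreover have "finite (incident G v - {m v})" using F2[OF v] by (metis card.infinite zero_neq_numeral)
    ultimately have "card {e1, e2, e3} \<le> 2" using F2[OF v] card_mono by metis
    moreover have "card {e1, e2, e3} = 3" if "distinct [e1, e2, e3]" using that by simp
    ultimately show "\<not> distinct [e1, e2, e3]" by linarith
  qed
  then obtain tl hd where th: "\<And>e. e \<in> F \<Longrightarrow> ends G e = {tl e, hd e}" "inj_on tl F" "inj_on hd F" by blast
  have "\<exists>e\<in>F. tl e = v" if v: "v \<in> ?V" for v
  proof -
    obtain e e' where e: "incident G v - {m v} = {e, e'}" "e \<noteq> e'" using F2[OF v] by (auto simp: card_2_iff)
    have inF: "f \<in> F" "v \<in> ends G f" if "f \<in> {e, e'}" for f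
    proof -
      have f: "f \<in> edges G" "v \<in> ends G f" "f \<noteq> m v" using that e by (auto simp: incident_def)
      show "f \<in> F" using f m_unique[OF _ f(2) v] by (auto simp: F_def)
      show "v \<in> ends G f" by (rule f)
    qed
    show ?thesis
    proof (rule ccontr)
      assume "\<not> ?thesis"
      then have "hd e = v" "hd e' = v" using inF th(1) by auto
      then show False using th(3) inF e(2) by (auto dest: inj_onD)
    qed
  qed
  then obtain c where c: "\<And>v. v \<in> ?V \<Longrightarrow> c v \<in> F \<and> tl (c v) = v" by metis
  have c_tl: "e = c (tl e)" "tl e \<in> ?V" "hd e \<in> ?V" if "e \<in> F" for e
  proof -
    show V: "tl e \<in> ?V" "hd e \<in> ?V" using th(1)[OF that] ends_V[of e] that by (auto simp: F_def)
    show "e = c (tl e)" using inj_onD[OF th(2), of e "c (tl e)"] c[OF V(1)] that by auto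
  qed
  define s where "s v = (if v \<in> ?V then hd (c v) else v)" for v
  have c_ends: "ends G (c v) = {v, s v}" if "v \<in> ?V" for v
    using th(1)[of "c v"] c[OF that] that by (simp add: s_def)
  have cE: "c v \<in> edges G" if "v \<in> ?V" for v using c[OF that] by (simp add: F_def)
  have sV: "s v \<in> ?V" if "v \<in> ?V" for v
    using c_ends[OF that] ends_V[OF cE[OF that]] by auto
  have s_neq: "s v \<noteq> v" if "v \<in> ?V" for v
  proof -
    have "card (ends G (c v)) = 2" using mg cE[OF that] by (simp add: multigraph_def)
    then show ?thesis using c_ends[OF that] by auto
  qed
  have adj_s: "adj G v (s v)" if "v \<in> ?V" for v
    using c_ends[OF that] cE[OF that] by (auto simp: adj_def)
  have s_inj: "inj_on s ?V"
  proof (rule inj_onI)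
    fix u v assume uv: "u \<in> ?V" "v \<in> ?V" "s u = s v"
    then have "c u = c v" using c inj_onD[OF th(3), of "c u" "c v"] by (simp add: s_def)
    then show "u = v" using c uv by metis
  qed
  have "s ` ?V = ?V" using sV s_inj finV by (intro endo_inj_surj) auto
  then have perm: "s permutes ?V"
    using s_inj by (intro bij_imp_permutes) (auto simp: bij_betw_def s_def)
  define \<mu> where "\<mu> v = (SOME w. ends G (m v) = {v, w})" for v
  have mu: "ends G (m v) = {v, \<mu> v}" "\<mu> v \<noteq> v" "\<mu> v \<in> ?V" "adj G v (\<mu> v)" "m (\<mu> v) = m v"
    if v: "v \<in> ?V" for v
  proof -
    have mE: "m v \<in> edges G" using m[OF v] ME by blast
    obtain w where w: "ends G (m v) = {v, w}" "w \<noteq> v" "w \<in> ?V"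
      using multigraph_ends[OF mg mE] m[OF v] by metis
    then show 1: "ends G (m v) = {v, \<mu> v}" unfolding \<mu>_def by (metis (mono_tags) someI)
    then have "\<mu> v = w" using w by (auto simp: doubleton_eq_iff)
    then show "\<mu> v \<noteq> v" "\<mu> v \<in> ?V" using w by auto
    show "adj G v (\<mu> v)" using 1 mE by (auto simp: adj_def)
    show "m (\<mu> v) = m v" using m_unique[of "m v" "\<mu> v"] m[OF v] 1 \<open>\<mu> v \<in> ?V\<close> by auto
  qed
  have mu_mu: "\<mu> (\<mu> v) = v" if "v \<in> ?V" for v
    using mu[OF that] mu[OF mu(3)[OF that]] by (auto simp: doubleton_eq_iff)
  have prm: "permutation s" using finV perm permutation_permutes by blast
  have odd2: "s (s v) \<noteq> v" if "v \<in> ?V" "odd (least_power s v)" for v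
  proof
    assume "s (s v) = v"
    then have "(s ^^ 2) v = v" by (simp add: numeral_2_eq_2)
    then have "least_power s v dvd 2" using least_power_dvd[OF prm] by metis
    then have "least_power s v \<le> 2" by (simp add: dvd_imp_le)
    with that(2) have "least_power s v = 1" by (auto simp: le_Suc_eq numeral_2_eq_2)
    then have "(s ^^ 1) v = v" using least_power_of_permutation(1)[OF prm] by metis
    then show False using s_neq[OF that(1)] by simp
  qed
  interpret matched_perm ?V s \<mu>
  proof unfold_locales
    fix v assume v: "v \<in> ?V"
    note sv = sV[OF v] and ssv = sV[OF sV[OF v]] and sssv = sV[OF sV[OF sV[OF v]]]
    show "5 \<le> least_power s v" if "odd (least_power s v)"
    proof (rule ccontr)
      assume "\<not> ?thesis"
      moreover have arith: "n = 1 \<or> n = 3" if "odd n" "\<not> 5 \<le> n" for n :: nat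
        using that by presburger
      ultimately have "least_power s v = 1 \<or> least_power s v = 3"
        using arith that by blast
      then consider "(s ^^ 1) v = v" | "(s ^^ 3) v = v"
        using least_power_of_permutation(1)[OF prm, of v] by metis
      then show False
      proof cases
        case 1
        then show False using s_neq[OF v] by simp
      next
        case 2
        then have 3: "s (s (s v)) = v" by (simp add: numeral_3_eq_3)
        have "distinct [v, s v, s (s v)]"
          using s_neq[OF v] s_neq[OF sv] s_neq[OF ssv] odd2[OF v that] by auto
        then show False using no3 adj_s[OF v] adj_s[OF sv] adj_s[OF ssv] 3 by metis
      qed
    qed
    show "\<mu> v \<noteq> s (s v)" if "odd (least_power s v)"
    proof
      assume eq: "\<mu> v = s (s v)"
      have "distinct [v, s v, s (s v)]"
        using s_neq[OF v] s_neq[OF sv] odd2[OF v that] by auto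
      moreover have "adj G (s (s v)) v" using mu(4)[OF v] eq adj_sym by metis
      ultimately show False using no3 adj_s[OF v] adj_s[OF sv] by metis
    qed
    show "\<mu> v \<noteq> s (s (s v))" if "odd (least_power s v)"
    proof
      assume eq: "\<mu> v = s (s (s v))"
      have "s (s (s v)) \<noteq> s v" using odd2[OF v that] inj_onD[OF s_inj _ ssv v] by blast
      then have "distinct [v, s v, s (s v), s (s (s v))]"
        using s_neq[OF v] s_neq[OF sv] s_neq[OF ssv] odd2[OF v that] mu(2)[OF v] eq by auto
      moreover have "adj G (s (s (s v))) v" using mu(4)[OF v] eq adj_sym by metis
      ultimately show False using no4 adj_s[OF v] adj_s[OF sv] adj_s[OF ssv] by metis
    qed
  qed (use finV perm mu mu_mu in auto)
  obtain t x where t: "\<And>v. t v < 11" "\<And>v. v \<in> ?V \<Longrightarrow> t (\<mu> v) = t v"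
    and x: "\<And>v. v \<in> ?V \<Longrightarrow> x v < 11 \<and> far (x v) (t v) \<and> far (x v) (t (s v)) \<and> far (x v) (x (s v))"
    using ex_colors by metis
  \<comment> \<open>Either end of a matching edge may be picked, since \<open>t\<close> is invariant
    under \<open>\<mu>\<close>.\<close>
  define f where "f e = (if e \<in> M then t (SOME v. v \<in> ends G e) else x (tl e))" for e
  have fm: "f (m v) = t v" if v: "v \<in> ?V" for v
  proof -
    have "(SOME w. w \<in> ends G (m v)) \<in> {v, \<mu> v}"
      using mu(1)[OF v] by (metis insertI1 someI)
    then show ?thesis using m[OF v] t(2)[OF v] by (auto simp: f_def)
  qed
  have fF: "f e = x (tl e)" if "e \<in> F" for e using that by (simp add: f_def F_def)
  have hd_s: "hd e = s (tl e)" if "e \<in> F" for e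
    using c_tl[OF that] by (simp add: s_def)
  have "proper_at G f v" if v: "v \<in> ?V" for v
    unfolding proper_at_def
  proof (intro ballI impI)
    have dicho: "e = m v \<or> (e \<in> F \<and> (tl e = v \<or> s (tl e) = v))" if "e \<in> incident G v" for e
    proof (cases "e \<in> M")
      case True
      then show ?thesis using m_unique that v by (auto simp: incident_def)
    next
      case False
      then have "e \<in> F" "v \<in> ends G e" using that by (auto simp: F_def incident_def)
      then show ?thesis using th(1)[of e] hd_s by auto
    qed
    have xt: "far (f e) (t v)" if "e \<in> F" "tl e = v \<or> s (tl e) = v" for e
      using x[OF c_tl(2)[OF that(1)]] that fF by auto
    fix e e' assume e: "e \<in> incident G v" "e' \<in> incident G v" "e \<noteq> e'"
    show "far (f e) (f e')"
    proof (cases "e = m v \<or> e' = m v")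
      case True
      then show ?thesis using dicho[OF e(1)] dicho[OF e(2)] e(3) xt fm[OF v] far_sym by metis
    next
      case False
      then have F: "e \<in> F" "e' \<in> F" "tl e = v \<or> s (tl e) = v" "tl e' = v \<or> s (tl e') = v"
        using dicho e by blast+
      have "tl e \<noteq> tl e'" using inj_onD[OF th(2) _ F(1,2)] e(3) by blast
      moreover have "s (tl e) \<noteq> s (tl e')" using inj_onD[OF th(3) _ F(1,2)] e(3) hd_s F by metis
      ultimately consider "tl e = v" "s (tl e') = v" | "tl e' = v" "s (tl e) = v" using F by metis
      then show ?thesis
      proof cases
        case 1
        then show ?thesis using x[OF c_tl(2)[OF F(2)]] fF F far_sym by metis
      next
        case 2
        then show ?thesis using x[OF c_tl(2)[OF F(1)]] fF F by metis
      qed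
    qed
  qed
  moreover have "f e < 11" if "e \<in> edges G" for e
  proof (cases "e \<in> M")
    case True
    then show ?thesis using t(1) by (simp add: f_def)
  next
    case False
    then have "e \<in> F" using that by (simp add: F_def)
    then show ?thesis using fF x[OF c_tl(2)] by metis
  qed
  ultimately show ?thesis unfolding edge_coloring_def by blast
qed

section \<open>Colouring bridgeless cubic multigraphs\<close>

lemma far_rotate:
  assumes "i < 11" "j < 11" "c < 11"
  shows "far ((i + c) mod 11) ((j + c) mod 11) \<longleftrightarrow> far i j"
proof -
  have "(k + c) mod 11 = (if k + c < 11 then k + c else k + c - 11)" if "k < 11" for k
    using that assms(3) by (auto simp: mod_if)
  then show ?thesis using assms by (auto simp: far_def)
qed

lemma unrotate:
  assumes "\<alpha> < 11" "c < 11"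
  obtains i where "i < 11" "\<alpha> = (i + c) mod (11::nat)"
proof (cases "c \<le> \<alpha>")
  case True
  then show ?thesis using that[of "\<alpha> - c"] assms by simp
next
  case False
  then show ?thesis using that[of "\<alpha> + 11 - c"] assms by simp
qed

lemma ex_far2:
  assumes "\<beta> < 11"
  obtains z z' where "z < 11" "z' < 11" "far \<beta> z" "far \<beta> z'" "far z z'"
proof -
  let ?r = "\<lambda>i. (i + \<beta>) mod 11"
  have "far 0 3" "far 0 6" "far 3 6" by (simp_all add: far_def)
  then have "far (?r 0) (?r 3)" "far (?r 0) (?r 6)" "far (?r 3) (?r 6)"
    using far_rotate[of 0 3 \<beta>] far_rotate[of 0 6 \<beta>] far_rotate[of 3 6 \<beta>] assms by simp_all
  then show ?thesis using that[of "?r 3" "?r 6"] assms by simp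
qed

text \<open>This serves a square with outer colour \<open>\<beta>\<close> at two adjacent corners
  and \<open>\<pi>\<close> at the other two. The two sides between differently coloured corners
  share the colour \<open>z\<close>, and \<open>H\<close> and \<open>K\<close> go to the sides at
  the \<open>\<beta>\<close> and the \<open>\<pi>\<close> corners.\<close>

lemma ex_far_square:
  assumes "\<beta> < 11" "\<pi> < 11"
  obtains z H K where "z < 11" "H < 11" "K < 11" "far \<beta> z" "far \<pi> z" "far \<beta> H" "far z H"
    "far \<pi> K" "far z K"
proof -
  let ?r = "\<lambda>i. (i + \<beta>) mod 11"
  obtain i where i: "i < 11" "\<pi> = ?r i" using unrotate[OF assms(2,1)] .
  have \<beta>: "\<beta> = ?r 0" using assms by simp
  have "\<exists>z H K. z < 11 \<and> H < 11 \<and> K < 11 \<and> far 0 z \<and> far i z \<and> far 0 H \<and> far z H \<and> far i K \<and> far z K"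
  proof -
    consider "i \<le> 2" | "3 \<le> i" "i \<le> 5" | "6 \<le> i" "i \<le> 8" | "9 \<le> i" by linarith
    then show ?thesis
    proof cases
      case 1
      then show ?thesis by (intro exI[of _ 8] exI[of _ 4] exI[of _ 5]) (auto simp: far_def)
    next
      case 2
      then show ?thesis by (intro exI[of _ 8] exI[of _ 4] exI[of _ 0]) (auto simp: far_def)
    next
      case 3
      then show ?thesis by (intro exI[of _ 3] exI[of _ 7] exI[of _ 0]) (auto simp: far_def)
    next
      case 4
      then show ?thesis using i by (intro exI[of _ 3] exI[of _ 7] exI[of _ 6]) (auto simp: far_def)
    qed
  qed
  then obtain z H K where *: "z < 11" "H < 11" "K < 11" "far 0 z" "far i z" "far 0 H" "far z H"
    "far i K" "far z K" by blast
  then have "far (?r 0) (?r z)" "far (?r i) (?r z)" "far (?r 0) (?r H)" "far (?r z) (?r H)"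
    "far (?r i) (?r K)" "far (?r z) (?r K)"
    using far_rotate[OF _ _ assms(1)] i(1) zero_less_numeral by blast+
  then show ?thesis using that[of "?r z" "?r H" "?r K"] i(2) assms(1) by simp
qed

text \<open>The square has outer colours \<open>\<beta>\<close>, \<open>\<alpha>\<close>,
  \<open>\<theta>\<close>, \<open>\<pi>\<close> in cyclic order, and \<open>X\<close>,
  \<open>H\<close>, \<open>Y\<close>, \<open>K\<close> are its sides. After rotating
  \<open>\<gamma>\<close> to 0, two mutually far colours that are far from 0 lie one in 3..5 and the
  other in 6..8.\<close>

lemma ex_far_ladder:
  assumes lt: "\<alpha> < 11" "\<beta> < 11" "\<gamma> < 11" "\<pi> < 11" "\<theta> < 11"
    and far: "far \<alpha> \<gamma>" "far \<alpha> \<pi>" "far \<pi> \<gamma>" "far \<beta> \<gamma>" "far \<beta> \<theta>" "far \<theta> \<gamma>"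
  obtains X Y H K where "X < 11" "Y < 11" "H < 11" "K < 11"
    "far \<beta> X" "far \<beta> H" "far X H" "far \<alpha> Y" "far \<alpha> H" "far Y H"
    "far \<pi> X" "far \<pi> K" "far X K" "far \<theta> Y" "far \<theta> K" "far Y K"
proof -
  let ?r = "\<lambda>i. (i + \<gamma>) mod 11"
  obtain a where a: "a < 11" "\<alpha> = ?r a" using unrotate[OF lt(1,3)] .
  obtain b where b: "b < 11" "\<beta> = ?r b" using unrotate[OF lt(2,3)] .
  obtain p where p: "p < 11" "\<pi> = ?r p" using unrotate[OF lt(4,3)] .
  obtain q where q: "q < 11" "\<theta> = ?r q" using unrotate[OF lt(5,3)] .
  note rot = far_rotate[OF _ _ lt(3)]
  have g: "\<gamma> = ?r 0" using lt by simp
  have "far (?r a) (?r 0)" "far (?r a) (?r p)" "far (?r p) (?r 0)" "far (?r b) (?r 0)"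
    "far (?r b) (?r q)" "far (?r q) (?r 0)"
    using far unfolding a(2) b(2) p(2) q(2) g[symmetric] by simp_all
  then have f: "far a 0" "far a p" "far p 0" "far b 0" "far b q" "far q 0"
    using rot a(1) b(1) p(1) q(1) zero_less_numeral by blast+
  define low high where "low i \<longleftrightarrow> 3 \<le> i \<and> i \<le> 5" and "high i \<longleftrightarrow> 6 \<le> i \<and> i \<le> 8" for i :: nat
  have "low a \<and> high p \<or> high a \<and> low p" "low b \<and> high q \<or> high b \<and> low q"
    using f by (auto simp: far_def low_def high_def)
  then consider "low a" "high p" "low b" "high q" | "low a" "high p" "high b" "low q"
    | "high a" "low p" "low b" "high q" | "high a" "low p" "high b" "low q" by blast
  then have "\<exists>X Y H K. X < 11 \<and> Y < 11 \<and> H < 11 \<and> K < 11 \<and>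
    far b X \<and> far b H \<and> far X H \<and> far a Y \<and> far a H \<and> far Y H \<and>
    far p X \<and> far p K \<and> far X K \<and> far q Y \<and> far q K \<and> far Y K"
  \<comment> \<open>A side between one low and one high outer colour gets 0, a side between two low
    ones 8, between two high ones 3. These values suit their neighbours, and 0, 3, 8 are mutually
    far.\<close>
  proof cases
    case 1
    then show ?thesis
      by (intro exI[of _ 0] exI[of _ 0] exI[of _ 8] exI[of _ 3]) (auto simp: far_def low_def high_def)
  next
    case 2
    then show ?thesis
      by (intro exI[of _ 3] exI[of _ 8] exI[of _ 0] exI[of _ 0]) (auto simp: far_def low_def high_def)
  next
    case 3
    then show ?thesis
      by (intro exI[of _ 8] exI[of _ 3] exI[of _ 0] exI[of _ 0]) (auto simp: far_def low_def high_def)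
  next
    case 4
    then show ?thesis
      by (intro exI[of _ 0] exI[of _ 0] exI[of _ 3] exI[of _ 8]) (auto simp: far_def low_def high_def)
  qed
  then obtain X Y H K where *: "X < 11" "Y < 11" "H < 11" "K < 11"
    "far b X" "far b H" "far X H" "far a Y" "far a H" "far Y H"
    "far p X" "far p K" "far X K" "far q Y" "far q K" "far Y K" by blast
  show ?thesis
    by (rule that[of "?r X" "?r Y" "?r H" "?r K"]; (unfold a(2) b(2) p(2) q(2))?)
      (use * a(1) b(1) p(1) q(1) rot in simp_all)
qed

lemma proper_atD:
  "proper_at G f v \<Longrightarrow> e \<in> incident G v \<Longrightarrow> e' \<in> incident G v \<Longrightarrow> e \<noteq> e' \<Longrightarrow> far (f e) (f e')"
  by (simp add: proper_at_def)

lemma proper_at3: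
  assumes "incident G v = {p, q, r}" "far (f p) (f q)" "far (f p) (f r)" "far (f q) (f r)"
  shows "proper_at G f v"
  using assms far_sym by (auto simp: proper_at_def)

lemma proper_at_cong:
  assumes "proper_at G f v" "\<And>e. e \<in> incident G v \<Longrightarrow> f e = g e"
  shows "proper_at G g v"
  using assms by (simp add: proper_at_def)

text \<open>Both outer edges inherit the colour of the suppressed edge. The equality is recorded
  because one of the square reductions depends on it.\<close>

lemma (in digon) ex_coloring:
  assumes f: "edge_coloring G1 f"
  shows "\<exists>f'. edge_coloring G f' \<and> f' g = f' k"
proof -
  define f1 where "f1 = f(k := f g)"
  note lift = lift_coloring[OF f, folded f1_def]
  have gk: "f1 g = f1 k" using dist by (simp add: f1_def)
  have "f1 g < 11" using lift(1)[OF es(3)] dist by auto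
  then obtain z z' where z: "z < 11" "z' < 11" "far (f1 g) z" "far (f1 g) z'" "far z z'"
    by (rule ex_far2)
  define f' where "f' = f1(h := z, h' := z')"
  have val: "f' h = z" "f' h' = z'" "f' g = f1 g" "f' k = f1 g"
    using dist gk by (auto simp: f'_def)
  have "proper_at G f' x" if x: "x \<in> verts G" for x
  proof -
    consider "x = u" | "x = v" | "x \<in> verts G - {u, v}" using x by blast
    then show ?thesis
    proof cases
      case 1
      then show ?thesis using proper_at3[of G x h h' g] inc_u z far_sym val by metis
    next
      case 2
      then show ?thesis using proper_at3[of G x h h' k] inc_v z far_sym val by metis
    next
      case 3
      have "f1 e = f' e" if "e \<in> incident G x" for e
        using that 3 ends by (auto simp: f'_def incident_def)
      then show ?thesis using proper_at_cong[OF lift(2)[OF 3]] by blast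
    qed
  qed
  moreover have "f' e < 11" if "e \<in> edges G" for e
    using lift(1)[OF that] z by (auto simp: f'_def)
  ultimately show ?thesis unfolding edge_coloring_def using val by metis
qed

lemma color_remove_pair:
  assumes G: "bridgeless_cubic G" and uv: "u \<in> verts G" "v \<in> verts G" "u \<noteq> v"
    and inc: "incident G u = incident G v" and f: "edge_coloring (remove_pair G u v) f"
  shows "\<exists>f'. edge_coloring G f'"
proof -
  note rp = remove_pair[OF G uv inc]
  have "card (incident G u) = 3" using bridgeless_cubicD(6)[OF G uv(1)] .
  then obtain h1 h2 h3 where h: "incident G u = {h1, h2, h3}" "distinct [h1, h2, h3]"
    by (auto simp: card_3_iff)
  define f' where "f' = f(h1 := 0, h2 := 3, h3 := 6)"
  have val: "f' h1 = 0" "f' h2 = 3" "f' h3 = 6" using h by (auto simp: f'_def)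
  have "proper_at G f' z" if z: "z \<in> verts G" for z
  proof (cases "z \<in> {u, v}")
    case True
    then have "incident G z = {h1, h2, h3}" using h inc by auto
    then show ?thesis by (rule proper_at3) (simp_all add: val far_def)
  next
    case False
    then have z': "z \<in> verts G - {u, v}" using z by simp
    have "proper_at (remove_pair G u v) f z"
      using f z' by (simp add: edge_coloring_def remove_pair_def)
    then have "proper_at G f z" by (simp add: proper_at_def rp(3)[OF z'])
    moreover have "f e = f' e" if "e \<in> incident G z" for e
    proof -
      have "e \<notin> incident G u" using rp(2)[of e] that False by (auto simp: incident_def)
      then show ?thesis using h by (simp add: f'_def)
    qed
    ultimately show ?thesis by (rule proper_at_cong)
  qed
  moreover have "f' e < 11" if "e \<in> edges G" for e
    using f that h by (auto simp: f'_def edge_coloring_def remove_pair_def)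
  ultimately show ?thesis unfolding edge_coloring_def by blast
qed

section \<open>Extending colourings over triangles and squares\<close>

context split_edge
begin

text \<open>With \<open>a = d\<close> the reduction contracts the triangle \<open>x, y, a\<close>.
  Each of its sides takes the colour of the outer edge at the opposite corner; lifting does this for
  \<open>e1\<close> and \<open>e4\<close>, and \<open>h\<close> takes the colour of
  \<open>e5\<close>.\<close>

lemma color_triangle:
  assumes bc: "bridgeless_cubic G1" and f: "edge_coloring G1 f"
    and tri: "a = d" "b \<noteq> a" and e5: "e5 \<in> edges G" "a \<in> ends G e5" "e5 \<notin> {e1, e4}"
  shows "\<exists>f'. edge_coloring G f'"
proof -
  define g where "g = f(e3 := f e1, e4 := f e2)"
  note lift = lift_coloring[OF bridgeless_cubicD(1)[OF bc] f, folded g_def]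
  define f' where "f' = g(h := f e5)"
  have e5': "e5 \<notin> {h, e1, e2, e3, e4}"
    using e5 ends tri out G1_ends_distinct[OF bridgeless_cubicD(1)[OF bc]] by auto
  have val: "f' h = f e5" "f' e1 = f e1" "f' e2 = f e2" "f' e3 = f e1" "f' e4 = f e2"
    using dist by (auto simp: f'_def g_def)
  have "proper_at G1 f a" using f verts_in by (simp add: edge_coloring_def)
  moreover have "a \<in> ends G1 e2" unfolding G1_simps(4) using tri(1) by blast
  then have "{e1, e2, e5} \<subseteq> incident G1 a"
    using es dist e5 e5' by (auto simp: incident_def)
  ultimately have far: "far (f e1) (f e2)" "far (f e1) (f e5)" "far (f e2) (f e5)"
    using proper_atD[of G1 f a] dist e5' by auto
  have "proper_at G f' v" if v: "v \<in> verts G" for v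
  proof -
    consider "v = x" | "v = y" | "v \<in> verts G - {x, y}" using v by blast
    then show ?thesis
    proof cases
      case 1
      then show ?thesis using proper_at3[of G v h e1 e2] inc_x far far_sym val by metis
    next
      case 2
      then show ?thesis using proper_at3[of G v h e3 e4] inc_y far far_sym val by metis
    next
      case 3
      have "g e = f' e" if "e \<in> incident G v" for e
        using that 3 ends by (auto simp: f'_def incident_def)
      then show ?thesis using proper_at_cong[OF lift(2)[OF 3]] by blast
    qed
  qed
  moreover have "f e5 < 11" using f e5 e5' by (auto simp: edge_coloring_def)
  then have "f' e < 11" if "e \<in> edges G" for e
    using lift(1)[OF that] by (auto simp: f'_def)
  ultimately show ?thesis unfolding edge_coloring_def by metis
qed

text \<open>The square is \<open>x, a, d, y\<close>. Its outer edges \<open>e2\<close>,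
  \<open>p\<close>, \<open>q\<close>, \<open>e3\<close> keep the colours that \<open>e2\<close>,
  \<open>p\<close>, \<open>q\<close>, \<open>e1\<close> have in \<open>G1\<close>, all far from the
  colour of \<open>k\<close>; the four sides are recoloured.\<close>

lemma color_square_crossed:
  assumes bc: "bridgeless_cubic G1" and f: "edge_coloring G1 f"
    and k: "ends G k = {a, d}" "{k, p, q} \<subseteq> E0"
    and inc: "incident G a = {e1, k, p}" "distinct [e1, k, p]" "incident G d = {e4, k, q}" "distinct [e4, k, q]"
  shows "\<exists>f'. edge_coloring G f'"
proof -
  define g where "g = f(e3 := f e1, e4 := f e2)"
  note lift = lift_coloring[OF bridgeless_cubicD(1)[OF bc] f, folded g_def]
  have kpq: "k \<notin> {h, e1, e2, e3, e4}" "p \<notin> {h, e1, e2, e3, e4}" "q \<notin> {h, e1, e2, e3, e4}"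
    using k(2) E0 by auto
  have inG: "k \<in> edges G" "p \<in> edges G" "q \<in> edges G" using k by (auto simp: E0_def)
  have apd: "a \<in> ends G p" "d \<in> ends G q" using inc by (auto simp: incident_def)
  have lt: "f e1 < 11" "f e2 < 11" "f k < 11" "f p < 11" "f q < 11"
    using f inG kpq es dist by (auto simp: edge_coloring_def)
  have "proper_at G1 f a" "proper_at G1 f d" using f verts_in by (simp_all add: edge_coloring_def)
  moreover have "{e1, k, p} \<subseteq> incident G1 a" "{e2, k, q} \<subseteq> incident G1 d"
    using es dist inG kpq k(1) apd by (auto simp: incident_def)
  ultimately have far: "far (f e1) (f k)" "far (f e1) (f p)" "far (f p) (f k)"
    "far (f e2) (f k)" "far (f e2) (f q)" "far (f q) (f k)"
    using proper_atD[of G1 f] kpq inc by auto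
  obtain X Y H K where XY: "X < 11" "Y < 11" "H < 11" "K < 11"
    "far (f e2) X" "far (f e2) H" "far X H" "far (f e1) Y" "far (f e1) H" "far Y H"
    "far (f p) X" "far (f p) K" "far X K" "far (f q) Y" "far (f q) K" "far Y K"
    by (rule ex_far_ladder[OF lt far])
  define f' where "f' = g(e1 := X, e4 := Y, h := H, k := K)"
  have val: "f' e1 = X" "f' e4 = Y" "f' h = H" "f' k = K" "f' e2 = f e2" "f' e3 = f e1"
    "f' p = f p" "f' q = f q"
    using dist kpq inc by (auto simp: f'_def g_def)
  have "proper_at G f' v" if v: "v \<in> verts G" for v
  proof -
    consider "v = x" | "v = y" | "v = a" | "v = d" | "v \<in> verts G - {x, y}" "v \<notin> {a, d}" using v by blast
    then show ?thesis
    proof cases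
      case 1
      then show ?thesis using proper_at3[of G v h e1 e2] inc_x XY far_sym val by metis
    next
      case 2
      then show ?thesis using proper_at3[of G v h e3 e4] inc_y XY far_sym val by metis
    next
      case 3
      then show ?thesis using proper_at3[of G v e1 k p] inc XY far_sym val by metis
    next
      case 4
      then show ?thesis using proper_at3[of G v e4 k q] inc XY far_sym val by metis
    next
      case 5
      have "g e = f' e" if "e \<in> incident G v" for e
        using that 5 ends k by (auto simp: f'_def incident_def)
      then show ?thesis using proper_at_cong[OF lift(2)[OF 5(1)]] by blast
    qed
  qed
  moreover have "f' e < 11" if "e \<in> edges G" for e
    using lift(1)[OF that] XY by (auto simp: f'_def)
  ultimately show ?thesis unfolding edge_coloring_def by blast
qed

text \<open>The square is \<open>x, a, c, y\<close>, with \<open>ac\<close> parallel to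
  \<open>k\<close> in \<open>G1\<close>. The outer edges at \<open>x\<close> and \<open>y\<close>
  share the colour of \<open>bd\<close>, and \<open>p\<close> and \<open>q\<close> agree by
  hypothesis, which is the situation of \<open>ex_far_square\<close>.\<close>

lemma color_square_parallel:
  assumes bc: "bridgeless_cubic G1" and f: "edge_coloring G1 f" "f p = f q"
    and k: "ends G k = {a, c}" "{k, p, q} \<subseteq> E0"
    and inc: "incident G a = {e1, k, p}" "distinct [e1, k, p]" "incident G c = {e3, k, q}" "distinct [e3, k, q]"
  shows "\<exists>f'. edge_coloring G f'"
proof -
  define g where "g = f(e3 := f e1, e4 := f e2)"
  note lift = lift_coloring[OF bridgeless_cubicD(1)[OF bc] f(1), folded g_def]
  have kpq: "k \<notin> {h, e1, e2, e3, e4}" "p \<notin> {h, e1, e2, e3, e4}" "q \<notin> {h, e1, e2, e3, e4}"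
    using k(2) E0 by auto
  have inG: "p \<in> edges G" "q \<in> edges G" using k by (auto simp: E0_def)
  have lt: "f e2 < 11" "f p < 11"
    using f inG kpq es dist by (auto simp: edge_coloring_def)
  obtain z H K where z: "z < 11" "H < 11" "K < 11" "far (f e2) z" "far (f p) z" "far (f e2) H"
    "far z H" "far (f p) K" "far z K"
    using ex_far_square[OF lt] by metis
  define f' where "f' = g(e1 := z, e3 := z, h := H, k := K)"
  have val: "f' e1 = z" "f' e3 = z" "f' h = H" "f' k = K" "f' e2 = f e2" "f' e4 = f e2"
    "f' p = f p" "f' q = f p"
    using dist kpq inc f(2) by (auto simp: f'_def g_def)
  have "proper_at G f' v" if v: "v \<in> verts G" for v
  proof -
    consider "v = x" | "v = y" | "v = a" | "v = c" | "v \<in> verts G - {x, y}" "v \<notin> {a, c}" using v by blast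
    then show ?thesis
    proof cases
      case 1
      then show ?thesis using proper_at3[of G v h e1 e2] inc_x z far_sym val by metis
    next
      case 2
      then show ?thesis using proper_at3[of G v h e3 e4] inc_y z far_sym val by metis
    next
      case 3
      then show ?thesis using proper_at3[of G v e1 k p] inc z far_sym val by metis
    next
      case 4
      then show ?thesis using proper_at3[of G v e3 k q] inc z far_sym val by metis
    next
      case 5
      have "g e = f' e" if "e \<in> incident G v" for e
        using that 5 ends k by (auto simp: f'_def incident_def)
      then show ?thesis using proper_at_cong[OF lift(2)[OF 5(1)]] by blast
    qed
  qed
  moreover have "f' e < 11" if "e \<in> edges G" for e
    using lift(1)[OF that] z by (auto simp: f'_def)
  ultimately show ?thesis unfolding edge_coloring_def by blast
qed

end

theorem bridgeless_cubic_coloring: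
  fixes G :: "('v, 'e) mgraph"
  assumes "bridgeless_cubic G"
  shows "\<exists>f. edge_coloring G f"
  using assms
proof (induction "card (verts G)" arbitrary: G rule: less_induct)
  case less
  note G = less.prems
  have mg: "multigraph G" using bridgeless_cubicD(1)[OF G] .
  have smaller: "card (verts G - {p, q}) < card (verts G)" if "p \<in> verts G" for p q
    using bridgeless_cubicD(3)[OF G] that by (intro psubset_card_mono) auto
  have IH: "\<exists>f. edge_coloring H f"
    if "bridgeless_cubic H" "verts H = verts G - {p, q}" "p \<in> verts G"
    for H :: "('v, 'e) mgraph" and p q
    using less.hyps[of H] that smaller by simp
  have other: "\<exists>w. ends G e = {v, w} \<and> w \<noteq> v \<and> w \<in> verts G" if "e \<in> edges G" "v \<in> ends G e" for e v
    using multigraph_ends[OF mg that] by metis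
  show ?case
  proof (cases "\<exists>h\<in>edges G. \<exists>h'\<in>edges G. h \<noteq> h' \<and> ends G h = ends G h'")
    case True
    then obtain h h' where h: "h \<in> edges G" "h' \<in> edges G" "h \<noteq> h'" "ends G h = ends G h'" by blast
    obtain u v where uv: "ends G h = {u, v}" "v \<noteq> u" "u \<in> verts G" "v \<in> verts G"
      using multigraph_obtain_ends[OF mg h(1)] .
    obtain g where g: "incident G u = {h, h', g}" "distinct [h, h', g]"
      using incident_third[OF G uv(3) h(1) _ h(2)] h uv by auto
    obtain k where k: "incident G v = {h, h', k}" "distinct [h, h', k]"
      using incident_third[OF G uv(4) h(1) _ h(2)] h uv by auto
    have gk: "g \<in> edges G" "u \<in> ends G g" "k \<in> edges G" "v \<in> ends G k"
      using g k by (auto simp: incident_def)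
    note u_in = uv(3)
    show ?thesis
    proof (cases "g = k")
      case True
      then have inc: "incident G u = incident G v" using g k by simp
      have "verts (remove_pair G u v) = verts G - {u, v}" by (simp add: remove_pair_def)
      then obtain f where "edge_coloring (remove_pair G u v) f"
        using IH[OF remove_pair(1)[OF G uv(3,4) uv(2)[symmetric] inc] _ uv(3)] by blast
      then show ?thesis using color_remove_pair[OF G uv(3,4) uv(2)[symmetric] inc] by blast
    next
      case False
      obtain w where w: "ends G g = {u, w}" "w \<noteq> u" using other[OF gk(1,2)] by blast
      obtain w' where w': "ends G k = {v, w'}" "w' \<noteq> v" using other[OF gk(3,4)] by blast
      have "g \<notin> incident G v" "k \<notin> incident G u" using g k False by auto
      then have "w \<noteq> v" "w' \<noteq> u" using gk w w' by (auto simp: incident_def)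
      then interpret digon G u v h h' g k w w'
        using G g k h gk uv w w' False by unfold_locales auto
      show ?thesis using IH[OF bridgeless_cubic_G1 G1_simps(1) u_in] ex_coloring by blast
    qed
  next
    case False
    then have simple: "h = h'" if "h \<in> edges G" "h' \<in> edges G" "ends G h = ends G h'" for h h'
      using that by blast
    show ?thesis
    proof (cases "\<exists>x y z. distinct [x, y, z] \<and> adj G x y \<and> adj G y z \<and> adj G z x")
      case True
      then obtain x y z where tri: "distinct [x, y, z]" and adjs: "adj G x y" "adj G y z" "adj G z x"
        by blast
      obtain h where h: "h \<in> edges G" "ends G h = {x, y}" using adjs(1) by (auto simp: adj_def)
      obtain e4 where e4: "e4 \<in> edges G" "ends G e4 = {y, z}" using adjs(2) by (auto simp: adj_def)
      obtain e1 where e1: "e1 \<in> edges G" "ends G e1 = {x, z}"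
        using adjs(3) by (auto simp: adj_def insert_commute)
      have ne: "h \<noteq> e1" "h \<noteq> e4" "e1 \<noteq> e4" using tri h e1 e4 by (auto simp: doubleton_eq_iff)
      have V: "x \<in> verts G" "y \<in> verts G" "z \<in> verts G"
        using mg h e1 unfolding multigraph_def by blast+
      obtain e2 where e2: "incident G x = {h, e1, e2}" "distinct [h, e1, e2]"
        using incident_third[OF G V(1) h(1) _ e1(1)] h e1 ne by auto
      obtain e3 where e3: "incident G y = {h, e4, e3}" "distinct [h, e4, e3]"
        using incident_third[OF G V(2) h(1) _ e4(1)] h e4 ne by auto
      obtain e5 where e5: "incident G z = {e1, e4, e5}" "distinct [e1, e4, e5]"
        using incident_third[OF G V(3) e1(1) _ e4(1)] e1 e4 ne by auto
      have inE: "e2 \<in> edges G" "x \<in> ends G e2" "e3 \<in> edges G" "y \<in> ends G e3" "e5 \<in> edges G" "z \<in> ends G e5"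
        using e2 e3 e5 by (auto simp: incident_def)
      obtain b where b: "ends G e2 = {x, b}" "b \<noteq> x" using other[OF inE(1,2)] by blast
      obtain c where c: "ends G e3 = {y, c}" "c \<noteq> y" using other[OF inE(3,4)] by blast
      have bc: "b \<noteq> y" "b \<noteq> z" "c \<noteq> x" "c \<noteq> z"
        using simple[OF inE(1) h(1)] simple[OF inE(1) e1(1)] simple[OF inE(3) h(1)]
          simple[OF inE(3) e4(1)] b c h e1 e4 e2 e3 by (auto simp: insert_commute)
      have "e2 \<noteq> e3" "e1 \<noteq> e3" "e2 \<noteq> e4" using b c bc e1 e4 tri by (auto simp: doubleton_eq_iff)
      then have split: "split_edge G x y h e1 e2 e3 e4 z b c z"
        using G h e1 e4 inE b c bc tri ne e2 e3 by unfold_locales auto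
      \<comment> \<open>The other reduction would turn \<open>e1\<close> into a loop at
        \<open>z\<close>, so Frink's lemma must yield the contraction of the triangle.\<close>
      have "\<not> bridgeless_cubic (split_edge.G1 G x y h e1 e2 e4 e3 z b z c)"
      proof
        interpret B: split_edge G x y h e1 e2 e4 e3 z b z c by (rule split_edge.swap[OF split])
        assume "bridgeless_cubic B.G1"
        then show False using B.G1_ends_distinct bridgeless_cubicD(1) by blast
      qed
      then have bcub: "bridgeless_cubic (split_edge.G1 G x y h e1 e2 e3 e4 z b c z)"
        using frink[OF split] by blast
      interpret split_edge G x y h e1 e2 e3 e4 z b c z by (rule split)
      obtain f where "edge_coloring G1 f" using IH[OF bcub G1_simps(1) V(1)] by blast
      then show ?thesis using color_triangle[OF bcub _ refl bc(2) inE(5,6)] e5 by auto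
    next
      case no3: False
      show ?thesis
      proof (cases "\<exists>x y c a. distinct [x, y, c, a] \<and> adj G x y \<and> adj G y c \<and> adj G c a \<and> adj G a x")
        case True
        then obtain x y c a where sq: "distinct [x, y, c, a]"
          and adjs: "adj G x y" "adj G y c" "adj G c a" "adj G a x"
          by blast
        obtain h where h: "h \<in> edges G" "ends G h = {x, y}" using adjs(1) by (auto simp: adj_def)
        obtain e3 where e3: "e3 \<in> edges G" "ends G e3 = {y, c}" using adjs(2) by (auto simp: adj_def)
        obtain k where k: "k \<in> edges G" "ends G k = {a, c}"
          using adjs(3) by (auto simp: adj_def insert_commute)
        obtain e1 where e1: "e1 \<in> edges G" "ends G e1 = {x, a}"
          using adjs(4) by (auto simp: adj_def insert_commute)
        have ne: "h \<noteq> e1" "h \<noteq> e3" "e1 \<noteq> e3" "h \<noteq> k" "e1 \<noteq> k" "e3 \<noteq> k"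
          using sq h e1 e3 k by (auto simp: doubleton_eq_iff)
        have V: "x \<in> verts G" "y \<in> verts G" "a \<in> verts G" "c \<in> verts G"
          using mg h k unfolding multigraph_def by blast+
        obtain e2 where e2: "incident G x = {h, e1, e2}" "distinct [h, e1, e2]"
          using incident_third[OF G V(1) h(1) _ e1(1)] h e1 ne by auto
        obtain e4 where e4: "incident G y = {h, e3, e4}" "distinct [h, e3, e4]"
          using incident_third[OF G V(2) h(1) _ e3(1)] h e3 ne by auto
        obtain p where p: "incident G a = {e1, k, p}" "distinct [e1, k, p]"
          using incident_third[OF G V(3) e1(1) _ k(1)] e1 k ne by auto
        obtain q where q: "incident G c = {e3, k, q}" "distinct [e3, k, q]"
          using incident_third[OF G V(4) e3(1) _ k(1)] e3 k ne by auto
        have inE: "e2 \<in> edges G" "x \<in> ends G e2" "e4 \<in> edges G" "y \<in> ends G e4"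
          "p \<in> edges G" "a \<in> ends G p" "q \<in> edges G" "c \<in> ends G q"
          using e2 e4 p q by (auto simp: incident_def)
        obtain b where b: "ends G e2 = {x, b}" "b \<noteq> x" using other[OF inE(1,2)] by blast
        obtain d where d: "ends G e4 = {y, d}" "d \<noteq> y" using other[OF inE(3,4)] by blast
        obtain p' where p': "ends G p = {a, p'}" "p' \<noteq> a" using other[OF inE(5,6)] by blast
        obtain q' where q': "ends G q = {c, q'}" "q' \<noteq> c" using other[OF inE(7,8)] by blast
        have nochord: "\<not> adj G x c" "\<not> adj G y a"
          using no3 adjs sq adj_sym[of G] by (metis distinct_length_2_or_more distinct_singleton)+
        have out: "b \<notin> {y, a, c}" "d \<notin> {x, a, c}" "p' \<notin> {x, y, c}" "q' \<notin> {x, y, a}"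
        proof -
          show "b \<notin> {y, a, c}"
            using simple[OF inE(1) h(1)] simple[OF inE(1) e1(1)] nochord(1) b h e1 e2 inE(1)
            by (auto simp: adj_def)
          show "d \<notin> {x, a, c}"
            using simple[OF inE(3) h(1)] simple[OF inE(3) e3(1)] nochord(2) d h e3 e4 inE(3)
            by (auto simp: adj_def insert_commute)
          show "p' \<notin> {x, y, c}"
            using simple[OF inE(5) e1(1)] simple[OF inE(5) k(1)] nochord(2) p' k e1 p inE(5)
            by (auto simp: adj_def insert_commute)
          show "q' \<notin> {x, y, a}"
            using simple[OF inE(7) e3(1)] simple[OF inE(7) k(1)] nochord(1) q' k e3 q inE(7)
            by (auto simp: adj_def insert_commute)
        qed
        have pq: "p \<noteq> q" "e2 \<noteq> e4" "e2 \<noteq> e3" "e1 \<noteq> e4"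
          using p' q' b d e3 e1 out sq by (auto simp: doubleton_eq_iff)
        have split: "split_edge G x y h e1 e2 e3 e4 a b c d"
          using G h e1 e3 inE b d out sq ne e2 e4 pq by unfold_locales auto
        interpret A: split_edge G x y h e1 e2 e3 e4 a b c d by (rule split)
        interpret B: split_edge G x y h e1 e2 e4 e3 a b d c by (rule A.swap)
        have E0: "{k, p, q} \<subseteq> A.E0" "{k, p, q} \<subseteq> B.E0"
        proof -
          have "a \<notin> ends G e" if "e \<in> {h, e2, e3, e4}" for e
            using that h(2) e3(2) b(1) d(1) out sq by auto
          then have "k \<notin> {h, e2, e3, e4}" "p \<notin> {h, e2, e3, e4}"
            using k(2) inE(6) by blast+
          moreover have "c \<notin> ends G e" if "e \<in> {h, e1, e2, e4}" for e
            using that h(2) e1(2) b(1) d(1) out sq by auto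
          then have "q \<notin> {h, e1, e2, e4}" using inE(8) by blast
          ultimately have "{k, p, q} \<inter> {h, e1, e2, e3, e4} = {}"
            using p(2) q(2) by auto
          then show "{k, p, q} \<subseteq> A.E0" "{k, p, q} \<subseteq> B.E0"
            using k inE by (auto simp: A.E0_def B.E0_def)
        qed
        from frink[OF split] show ?thesis
        proof
          assume bc: "bridgeless_cubic A.G1"
          have "k \<noteq> h \<and> k \<noteq> e1 \<and> k \<noteq> e2 \<and> k \<noteq> e3 \<and> k \<noteq> e4" "p \<noteq> h \<and> p \<noteq> e1 \<and> p \<noteq> e2 \<and> p \<noteq> e3 \<and> p \<noteq> e4"
            "q \<noteq> h \<and> q \<noteq> e1 \<and> q \<noteq> e2 \<and> q \<noteq> e3 \<and> q \<noteq> e4" using E0(1) by (auto simp: A.E0_def)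
          \<comment> \<open>Joining \<open>a\<close> and \<open>c\<close> creates an edge parallel
            to \<open>k\<close>. Suppressing this digon as well gives a colouring in which
            \<open>p\<close> and \<open>q\<close> agree.\<close>
          then interpret D: digon A.G1 a c e1 k p q p' q'
            using bc p q pq p' q' out sq k inE e1 ne by unfold_locales auto
          have "card (verts D.G1) < card (verts G)"
            using bridgeless_cubicD(3)[OF G] V by (intro psubset_card_mono) auto
          then obtain f where "edge_coloring D.G1 f"
            using less.hyps[OF _ D.bridgeless_cubic_G1] by blast
          then obtain f where f: "edge_coloring A.G1 f" "f p = f q" using D.ex_coloring by blast
          show ?thesis using A.color_square_parallel[OF bc f k(2) E0(1) p q] .
        next
          assume bc: "bridgeless_cubic B.G1"
          then obtain f where "edge_coloring B.G1 f" using IH[OF _ B.G1_simps(1) V(1)] by blast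
          then show ?thesis using B.color_square_crossed[OF bc _ k(2) E0(2) p q] by blast
        qed
      next
        case False
        show ?thesis
        proof (rule coloring_girth5[OF G])
          show "\<not> adj G z x" if "distinct [x, y, z]" "adj G x y" "adj G y z" for x y z
            using no3 that by blast
          show "\<not> adj G w x"
            if "distinct [x, y, z, w]" "adj G x y" "adj G y z" "adj G z w" for x y z w
            using False that by blast
        qed
      qed
    qed
  qed
qed

text \<open>If a single edge crosses \<open>S\<close>, then after its deletion reachability respects
  \<open>S\<close>, so its ends lie in different components, whereas a connected graph has only
  one.\<close>

lemma two_edge_connected_bridgeless:
  assumes mg: "multigraph G" and cub: "cubic G" and conn: "two_edge_connected G"
  shows "bridgeless_cubic G"
  unfolding bridgeless_cubic_def
proof (intro conjI allI impI mg cub)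
  fix S assume S: "S \<subseteq> verts G"
  show "card (cutset G S) \<noteq> 1"
  proof
    assume "card (cutset G S) = 1"
    then obtain e where cut: "cutset G S = {e}" by (auto simp: card_1_singleton_iff)
    then have e: "e \<in> edges G" "crosses (ends G e) S" by (auto simp: cutset_def)
    obtain p q where pq: "ends G e = {p, q}" "p \<in> verts G" "q \<in> verts G"
      using multigraph_obtain_ends[OF mg e(1)] .
    define H where "H = delete_edge G e"
    have H: "verts H = verts G" "edges H = edges G - {e}" "ends H = ends G"
      by (auto simp: H_def delete_edge_def)
    have inS: "y \<in> S \<longleftrightarrow> x \<in> S" if "(x, y) \<in> (adj_rel H)\<^sup>*" for x y
      using that
    proof (induction rule: rtrancl_induct)
      case (step y z)
      then obtain e' where e': "e' \<in> edges G" "e' \<noteq> e" "ends G e' = {y, z}"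
        by (auto simp: adj_rel_def H)
      then have "\<not> crosses (ends G e') S" using cut by (auto simp: cutset_def)
      then show ?case using e' step.IH by simp
    qed simp
    have reach: "(adj_rel G)\<^sup>* `` {x} = verts G" if "x \<in> verts G" for x
    proof
      have "y \<in> verts G" if "(x, y) \<in> (adj_rel G)\<^sup>*" for y
        using that \<open>x \<in> verts G\<close> mg
        by (induction rule: rtrancl_induct) (auto simp: adj_rel_def multigraph_def)
      then show "(adj_rel G)\<^sup>* `` {x} \<subseteq> verts G" by blast
      show "verts G \<subseteq> (adj_rel G)\<^sup>* `` {x}"
        using conn that by (auto simp: two_edge_connected_def connected_graph_def)
    qed
    then have "components G \<subseteq> {verts G}" by (auto simp: components_def quotient_def)
    then have "card (components G) \<le> 1" using card_mono[of "{verts G}"] by fastforce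
    moreover have "card (components H) \<ge> 2"
    proof -
      have "(adj_rel H)\<^sup>* `` {p} \<noteq> (adj_rel H)\<^sup>* `` {q}"
      proof
        assume "(adj_rel H)\<^sup>* `` {p} = (adj_rel H)\<^sup>* `` {q}"
        then have "(p, q) \<in> (adj_rel H)\<^sup>*" by blast
        then show False using inS e(2) pq by auto
      qed
      then have "card {(adj_rel H)\<^sup>* `` {p}, (adj_rel H)\<^sup>* `` {q}} = 2" by simp
      moreover have "{(adj_rel H)\<^sup>* `` {p}, (adj_rel H)\<^sup>* `` {q}} \<subseteq> components H"
        using pq by (auto simp: components_def H intro: quotientI)
      moreover have "finite (components H)"
        using mg by (simp add: components_def H quotient_def multigraph_def)
      ultimately show ?thesis using card_mono by metis
    qed
    ultimately have "cut_edge G e" using e(1) by (simp add: cut_edge_def H_def)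
    then show False using conn by (simp add: two_edge_connected_def)
  qed
qed

theorem corollary1p8:
  fixes G :: "('v, 'e) mgraph"
  assumes "multigraph G"
    and "cubic G"
    and "two_edge_connected G"
  shows "circular_chromatic_index G \<le> 11 / 3"
proof -
  obtain f where f: "edge_coloring G f"
    using bridgeless_cubic_coloring[OF two_edge_connected_bridgeless[OF assms]] by blast
  have "pq_coloring 11 3 (line_graph G) f"
    unfolding pq_coloring_def
  proof (intro conjI ballI allI impI)
    show "f e < 11" if "e \<in> verts (line_graph G)" for e
      using f that by (simp add: edge_coloring_def line_graph_def)
    fix s e e' assume s: "s \<in> edges (line_graph G)" "ends (line_graph G) s = {e, e'}"
    then have "s = {e, e'}" by (simp add: line_graph_def)
    then have e: "e \<in> edges G" "e' \<in> edges G" "e \<noteq> e'" "ends G e \<inter> ends G e' \<noteq> {}"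
      using s(1) by (auto simp: line_graph_def doubleton_eq_iff)
    then obtain v where v: "v \<in> ends G e" "v \<in> ends G e'" by blast
    then have "v \<in> verts G" using assms(1) e by (auto simp: multigraph_def)
    then have "far (f e) (f e')"
      using f e v by (auto simp: edge_coloring_def proper_at_def incident_def)
    then show "int 3 \<le> \<bar>int (f e) - int (f e')\<bar>" "\<bar>int (f e) - int (f e')\<bar> \<le> int 11 - int 3"
      by (simp_all add: far_def)
  qed
  then have "real 11 / real 3 \<in> circular_ratios (line_graph G)"
    unfolding circular_ratios_def by (intro CollectI exI[of _ 11] exI[of _ 3]) auto
  then show ?thesis
    unfolding circular_chromatic_index_def circular_chromatic_number_def
    using cInf_lower[OF _ bdd_below_circular_ratios] by force
qed

end
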